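(* Let $k\ge1$ be an integer and let $M=(\mathbf{R}/\mathbf{Z})^k$ with its standard flat metric (the quotient of the Euclidean metric on $\mathbf{R}^k$). For any Borel probability measures $\mu,\nu$ on $M$ and any $T>0$, \[\mathcal{W}_1(\mu,\nu)\le\frac{4\sqrt3\,\sqrt k}{T}+\Bigl(\sum_{\substack{\mathbf{h}\in\mathbf{Z}^k\\ 1\le\|\mathbf{h}\|_\infty\le T}}\frac{1}{\|\mathbf{h}\|^2}\,|\widehat\mu(\mathbf{h})-\widehat\nu(\mathbf{h})|^2\Bigr)^{1/2},\] where $\|\mathbf{h}\|$ is the Euclidean norm and $\widehat\mu(\mathbf{h})=\int_M e(\mathbf{h}\cdot x)\,d\mu(x)$, $e(z)=e^{2i\pi z}$.
   Context: For a metric space $(M,d)$ and Borel probability measures $\mu,\nu$ on $M$, $\mathcal{W}_1(\mu,\nu)=\inf_{\pi}\int_{M\times M}d(x,y)\,d\pi(x,y)$, the infimum over Borel probability measures $\pi$ on $M\times M$ with marginals $\mu$ and $\nu$ (the 1-Wasserstein distance). *)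

theory Defs
  imports "HOL-Probability.Probability"
begin

text \<open>The torus (R/Z)^k is represented by the fundamental domain [0,1)^k in real^'n,
  with k = CARD('n) (always at least 1).\<close>

definition torus_cube :: "(real^'n) set" where
  "torus_cube = {x. \<forall>i. 0 \<le> x$i \<and> x$i < 1}"

definition torus_dist :: "real^'n \<Rightarrow> real^'n \<Rightarrow> real" where
  "torus_dist x y = Inf {norm (x - y - z) | z. \<forall>i. z$i \<in> \<int>}"

definition torus_prob :: "(real^'n) measure \<Rightarrow> bool" where
  "torus_prob \<mu> \<longleftrightarrow> prob_space \<mu> \<and> sets \<mu> = sets (restrict_space borel torus_cube)"

definition coupling :: "(real^'n) measure \<Rightarrow> (real^'n) measure \<Rightarrow> ((real^'n) \<times> (real^'n)) measure \<Rightarrow> bool" where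
  "coupling \<mu> \<nu> \<pi> \<longleftrightarrow> prob_space \<pi> \<and> sets \<pi> = sets (\<mu> \<Otimes>\<^sub>M \<nu>) \<and>
     distr \<pi> \<mu> fst = \<mu> \<and> distr \<pi> \<nu> snd = \<nu>"

definition W1 :: "(real^'n) measure \<Rightarrow> (real^'n) measure \<Rightarrow> real" where
  "W1 \<mu> \<nu> = Inf {(\<integral>p. torus_dist (fst p) (snd p) \<partial>\<pi>) | \<pi>. coupling \<mu> \<nu> \<pi>}"

definition hvec :: "int^'n \<Rightarrow> real^'n" where
  "hvec h = (\<chi> i. real_of_int (h$i))"

definition fhat :: "(real^'n) measure \<Rightarrow> int^'n \<Rightarrow> complex" where
  "fhat \<mu> h = (\<integral>x. cis (2 * pi * (hvec h \<bullet> x)) \<partial>\<mu>)"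

end

theory Submission
  imports Defs "HOL-Real_Asymp.Real_Asymp"
begin

text \<open>
  Round both measures down to the grid \<open>(\<int>/N)\<^sup>k\<close> and let \<open>N \<rightarrow> \<infinity>\<close> at the end.  By finite Kantorovich
  duality it suffices to bound \<open>\<Sum> f (p - q)\<close> for 1-Lipschitz \<open>f\<close> on the grid, where \<open>p, q\<close> are the cell
  masses.  Convolving \<open>f\<close> with a nonnegative trigonometric kernel of degree \<open>m = \<lfloor>T\<rfloor>\<close> gives a 1-Lipschitz
  trigonometric polynomial \<open>P\<close> with \<open>\<bar>f - P\<bar> \<le> \<surd>k \<pi> / (2 (m + 2))\<close>.  For large \<open>N\<close> the gradient of \<open>P\<close> has
  norm below \<open>2\<pi>\<close>, so Parseval gives \<open>\<Sum> \<parallel>h\<parallel>\<^sup>2 \<bar>P\<^sub>h\<bar>\<^sup>2 \<le> 1\<close> for its Fourier coefficients \<open>P\<^sub>h\<close>, and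
  Cauchy-Schwarz bounds \<open>\<Sum> P (p - q)\<close> by the Fourier term of the theorem.
\<close>

section \<open>Finite Kantorovich duality\<close>

text \<open>On a grid, Kantorovich duality is Hahn-Banach in finitely many coordinates, and Parseval
  is orthogonality of the characters of \<open>(Z/N)^k\<close>. The price is that a test function
  has increments along grid vectors but no derivative; the gradient of the smoothed polynomial is
  recovered from such increments, up to a constant factor, once N is large compared with the fixed
  degree. The threshold on N depends on m and k alone, since a 1-Lipschitz function with
  \<open>f 0 = 0\<close> is bounded by \<open>sqrt k\<close> on the grid. The smoothing error comes
  from a single moment: the squared distance to the nearest integer is dominated by a multiple of
  \<open>1 - cos\<close>, and the kernel averages \<open>cos\<close> to
  \<open>cos (pi / (m + 2))\<close>, which is \<open>1 - O(1/m^2)\<close>. The signed weights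
  \<open>p - q\<close> have total variation at most 2, which doubles this error. Losses in the
  gradient bound are harmless, because differentiating \<open>e(h x)\<close> produces
  \<open>2 pi h\<close>, and \<open>4 pi^2\<close> is far above the bound 8 obtained for the squared
  gradient.\<close>

lemma sublinear_dominates_linear:
  fixes S :: "('a \<Rightarrow> real) \<Rightarrow> real"
  assumes "finite A"
    and sub: "\<And>\<phi> \<psi>. S (\<lambda>a. \<phi> a + \<psi> a) \<le> S \<phi> + S \<psi>"
    and hom: "\<And>t \<phi>. t > 0 \<Longrightarrow> S (\<lambda>a. t * \<phi> a) = t * S \<phi>"
    and zero: "S (\<lambda>a. 0) \<ge> 0"
  shows "\<exists>w. \<forall>\<phi>. (\<forall>a. a \<notin> A \<longrightarrow> \<phi> a = 0) \<longrightarrow> (\<Sum>a\<in>A. w a * \<phi> a) \<le> S \<phi>"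
  using \<open>finite A\<close>
proof (induction A rule: finite_induct)
  case empty
  have "0 \<le> S \<phi>" if "\<forall>a. \<phi> a = 0" for \<phi>
  proof -
    have "\<phi> = (\<lambda>a. 0)" using that by blast
    then show ?thesis using zero by (simp only:)
  qed
  then show ?case by simp
next
  case (insert b A)
  then obtain w where w: "\<And>\<phi>. (\<forall>a. a \<notin> A \<longrightarrow> \<phi> a = 0) \<Longrightarrow> (\<Sum>a\<in>A. w a * \<phi> a) \<le> S \<phi>"
    by blast
  define V where "V = {\<phi> :: 'a \<Rightarrow> real. \<forall>a. a \<notin> A \<longrightarrow> \<phi> a = 0}"
  define L where "L \<phi> = (\<Sum>a\<in>A. w a * \<phi> a)" for \<phi>
  define \<delta> where "\<delta> a = (if a = b then 1 else 0 :: real)" for a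
  have V0: "(\<lambda>a. 0) \<in> V" by (simp add: V_def)
  \<comment> \<open>This is the one-dimensional extension step of Hahn-Banach. The coefficient
    \<open>c\<close> at the new point \<open>b\<close> must lie above every left-hand side and below
    every right-hand side; scaling by \<open>1/|t|\<close> later reduces an arbitrary nonzero value
    at \<open>b\<close> to \<open>+1\<close> or \<open>-1\<close>.\<close>
  have sep: "L \<psi> - S (\<lambda>a. \<psi> a - \<delta> a) \<le> S (\<lambda>a. \<phi> a + \<delta> a) - L \<phi>" if "\<phi> \<in> V" "\<psi> \<in> V" for \<phi> \<psi>
  proof -
    have "L \<psi> + L \<phi> = L (\<lambda>a. \<psi> a + \<phi> a)"
      by (simp add: L_def algebra_simps sum.distrib)
    also have "\<dots> \<le> S (\<lambda>a. \<psi> a + \<phi> a)"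
      unfolding L_def by (rule w) (use that in \<open>auto simp: V_def\<close>)
    also have "\<dots> \<le> S (\<lambda>a. \<psi> a - \<delta> a) + S (\<lambda>a. \<phi> a + \<delta> a)"
      using sub[of "\<lambda>a. \<psi> a - \<delta> a" "\<lambda>a. \<phi> a + \<delta> a"] by (simp add: algebra_simps)
    finally show ?thesis by simp
  qed
  define c where "c = (SUP \<psi>\<in>V. L \<psi> - S (\<lambda>a. \<psi> a - \<delta> a))"
  have lower: "L \<psi> - S (\<lambda>a. \<psi> a - \<delta> a) \<le> c" if "\<psi> \<in> V" for \<psi>
    unfolding c_def using that sep[OF V0] by (intro cSUP_upper bdd_aboveI2)
  have upper: "c \<le> S (\<lambda>a. \<phi> a + \<delta> a) - L \<phi>" if "\<phi> \<in> V" for \<phi>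
    unfolding c_def using that sep V0 by (intro cSUP_least) auto
  have "(\<Sum>a\<in>insert b A. (w(b := c)) a * \<phi> a) \<le> S \<phi>" if \<phi>: "\<forall>a. a \<notin> insert b A \<longrightarrow> \<phi> a = 0" for \<phi>
  proof -
    define t where "t = \<phi> b"
    define \<psi> where "\<psi> = \<phi>(b := 0)"
    have \<psi>: "\<psi> \<in> V" using \<phi> by (auto simp: V_def \<psi>_def)
    have \<phi>_eq: "\<phi> = (\<lambda>a. \<psi> a + t * \<delta> a)" by (auto simp: \<psi>_def t_def \<delta>_def)
    have "(\<Sum>a\<in>A. (w(b := c)) a * \<phi> a) = L \<psi>"
      unfolding L_def using insert.hyps by (intro sum.cong) (auto simp: \<psi>_def)
    then have sum_eq: "(\<Sum>a\<in>insert b A. (w(b := c)) a * \<phi> a) = L \<psi> + t * c"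
      using insert.hyps by (simp add: t_def)
    have scaled: "(\<lambda>a. s * \<psi> a) \<in> V" "L (\<lambda>a. s * \<psi> a) = s * L \<psi>" for s
      using \<psi> by (auto simp: V_def L_def sum_distrib_left algebra_simps)
    consider "t = 0" | "t > 0" | "t < 0" by linarith
    then have "L \<psi> + t * c \<le> S \<phi>"
    proof cases
      case 1
      then show ?thesis using w[of \<psi>] \<psi> by (simp add: \<phi>_eq V_def L_def)
    next
      case 2
      have "S \<phi> = t * S (\<lambda>a. (1/t) * \<psi> a + \<delta> a)"
        using 2 by (subst hom[symmetric]) (auto simp: \<phi>_eq algebra_simps)
      moreover have "t * c \<le> t * (S (\<lambda>a. (1/t) * \<psi> a + \<delta> a) - (1/t) * L \<psi>)"
        using upper[OF scaled(1)[of "1/t"]] scaled(2)[of "1/t"] 2 by (intro mult_left_mono) auto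
      ultimately show ?thesis using 2 by (simp add: algebra_simps)
    next
      case 3
      have "S \<phi> = (-t) * S (\<lambda>a. (-1/t) * \<psi> a - \<delta> a)"
        using 3 by (subst hom[symmetric]) (auto simp: \<phi>_eq algebra_simps)
      moreover have "(-t) * ((-1/t) * L \<psi> - S (\<lambda>a. (-1/t) * \<psi> a - \<delta> a)) \<le> (-t) * c"
        using lower[OF scaled(1)[of "-1/t"]] scaled(2)[of "-1/t"] 3 by (intro mult_left_mono) auto
      ultimately show ?thesis using 3 by (simp add: algebra_simps)
    qed
    with sum_eq show ?thesis by simp
  qed
  then show ?case by blast
qed

lemma finite_kantorovich_duality:
  fixes p q :: "'a \<Rightarrow> real" and d :: "'a \<Rightarrow> 'a \<Rightarrow> real"
  assumes fin: "finite I"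
    and p: "\<And>i. i \<in> I \<Longrightarrow> 0 \<le> p i" "sum p I = 1"
    and q: "\<And>i. i \<in> I \<Longrightarrow> 0 \<le> q i" "sum q I = 1"
    and d_self: "\<And>i. i \<in> I \<Longrightarrow> d i i = 0"
    and d_tri: "\<And>i j k. i \<in> I \<Longrightarrow> j \<in> I \<Longrightarrow> k \<in> I \<Longrightarrow> d i k \<le> d i j + d j k"
    and bound: "\<And>f. (\<And>i j. i \<in> I \<Longrightarrow> j \<in> I \<Longrightarrow> f i - f j \<le> d i j) \<Longrightarrow> (\<Sum>i\<in>I. f i * (p i - q i)) \<le> D"
  obtains P where "\<And>i j. i \<in> I \<Longrightarrow> j \<in> I \<Longrightarrow> 0 \<le> P i j"
    "\<And>i. i \<in> I \<Longrightarrow> (\<Sum>j\<in>I. P i j) = p i"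
    "\<And>j. j \<in> I \<Longrightarrow> (\<Sum>i\<in>I. P i j) = q j"
    "(\<Sum>i\<in>I. \<Sum>j\<in>I. P i j * d i j) \<le> D"
proof -
  define obj :: "('a \<Rightarrow> real) \<Rightarrow> ('a \<Rightarrow> real) \<Rightarrow> real \<Rightarrow> real"
    where "obj u v l = (\<Sum>i\<in>I. p i * u i) + (\<Sum>j\<in>I. q j * v j) + l * D" for u v l
  define feas where "feas \<phi> = {(u, v, l). 0 \<le> l \<and> (\<forall>i\<in>I. \<forall>j\<in>I. \<phi> (i, j) \<le> u i + v j + l * d i j)}"
    for \<phi> :: "'a \<times> 'a \<Rightarrow> real"
  \<comment> \<open>The dual value of the cost \<open>\<phi>\<close>, with a multiple \<open>l\<close> of \<open>d\<close> priced at \<open>D\<close>: a linear functional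
    below \<open>S\<close> is a coupling of \<open>p\<close> and \<open>q\<close> whose cost for \<open>d\<close> is at most \<open>D\<close>.\<close>
  define S where "S \<phi> = (INF (u, v, l)\<in>feas \<phi>. obj u v l)" for \<phi>
  have I_ne: "I \<noteq> {}" using p(2) by auto
  have obj_add: "obj (\<lambda>i. u i + u' i) (\<lambda>i. v i + v' i) (l + l') = obj u v l + obj u' v' l'"
    for u v l u' v' l'
    by (simp add: obj_def algebra_simps sum.distrib)
  have obj_scale: "obj (\<lambda>i. t * u i) (\<lambda>i. t * v i) (t * l) = t * obj u v l" for t u v l
    by (simp add: obj_def algebra_simps sum_distrib_left)
  \<comment> \<open>The hypothesis \<open>bound\<close> speaks of one 1-Lipschitz function, the dual
    problem of a pair. The c-transform of \<open>v\<close> merges them: \<open>f\<close> is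
    1-Lipschitz by the triangle inequality, dominates \<open>u\<close> by feasibility and, as
    \<open>d i i = 0\<close>, satisfies \<open>v <= - f\<close>.\<close>
  have dual: "obj u v (-1) \<le> 0" if uv: "\<And>i j. i \<in> I \<Longrightarrow> j \<in> I \<Longrightarrow> u i + v j \<le> d i j" for u v
  proof -
    define f where "f i = Min ((\<lambda>j. d i j - v j) ` I)" for i
    have f_le: "f i \<le> d i j - v j" if "j \<in> I" for i j
      unfolding f_def using fin that by (intro Min_le) auto
    have f_ge: "c \<le> f i" if "\<And>j. j \<in> I \<Longrightarrow> c \<le> d i j - v j" for i c
      unfolding f_def using fin I_ne that by (subst Min_ge_iff) auto
    have "f i - f j \<le> d i j" if "i \<in> I" "j \<in> I" for i j
    proof -
      have "f i - d i j \<le> f j"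
      proof (rule f_ge)
        fix k assume "k \<in> I"
        then show "f i - d i j \<le> d j k - v k"
          using f_le[of k i] d_tri[OF that, of k] by simp
      qed
      then show ?thesis by simp
    qed
    then have "(\<Sum>i\<in>I. f i * (p i - q i)) \<le> D" by (rule bound)
    moreover have "(\<Sum>i\<in>I. p i * u i) \<le> (\<Sum>i\<in>I. p i * f i)"
      using uv by (intro sum_mono mult_left_mono p f_ge) (auto simp: le_diff_eq)
    moreover have "(\<Sum>i\<in>I. q i * v i) \<le> (\<Sum>i\<in>I. q i * (- f i))"
    proof (intro sum_mono mult_left_mono q)
      fix i assume "i \<in> I"
      then show "v i \<le> - f i" using f_le[of i i] d_self[of i] by simp
    qed
    ultimately show ?thesis
      by (simp add: obj_def algebra_simps sum_subtractf sum_negf)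
  qed
  \<comment> \<open>Weak duality at the zero cost, the source of all finiteness of \<open>S\<close>.
    For \<open>l = 0\<close> the constraints are averaged against the product of \<open>p\<close>
    and \<open>q\<close>; for \<open>l > 0\<close> division by \<open>- l\<close> turns them into a
    feasible pair for the cost \<open>d\<close>.\<close>
  have nonneg: "0 \<le> obj u v l" if "(u, v, l) \<in> feas (\<lambda>_. 0)" for u v l
  proof (cases "l = 0")
    case True
    have "0 \<le> (\<Sum>i\<in>I. \<Sum>j\<in>I. p i * q j * (u i + v j))"
      using that True p q by (intro sum_nonneg mult_nonneg_nonneg) (auto simp: feas_def)
    also have "\<dots> = (\<Sum>i\<in>I. p i * u i * (\<Sum>j\<in>I. q j)) + (\<Sum>i\<in>I. p i * (\<Sum>j\<in>I. q j * v j))"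
      by (simp add: sum_distrib_left sum.distrib algebra_simps)
    also have "\<dots> = obj u v l"
      unfolding sum_distrib_right[symmetric] by (simp add: obj_def True p q)
    finally show ?thesis .
  next
    case False
    with that have l: "l > 0" by (auto simp: feas_def)
    have "obj (\<lambda>i. (-1/l) * u i) (\<lambda>i. (-1/l) * v i) (-1) \<le> 0"
    proof (rule dual)
      fix i j assume "i \<in> I" "j \<in> I"
      then have "0 \<le> u i + v j + l * d i j" using that by (auto simp: feas_def)
      then show "(-1/l) * u i + (-1/l) * v j \<le> d i j"
        using l by (simp add: field_simps)
    qed
    then have "(-1/l) * obj u v l \<le> 0"
      using obj_scale[of "-1/l" u v l] l by simp
    then show ?thesis using l by (simp add: field_simps)
  qed
  have feas_ne: "feas \<phi> \<noteq> {}" for \<phi>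
  proof -
    have "\<phi> (i, j) \<le> Max (\<phi> ` (I \<times> I)) + 0 + 0 * d i j" if "i \<in> I" "j \<in> I" for i j
      using fin that by simp
    then have "((\<lambda>_. Max (\<phi> ` (I \<times> I))), (\<lambda>_. 0), 0) \<in> feas \<phi>"
      unfolding feas_def by blast
    then show ?thesis by blast
  qed
  have feas_add: "((\<lambda>i. u i + u' i), (\<lambda>i. v i + v' i), l + l') \<in> feas (\<lambda>a. \<phi> a + \<psi> a)"
    if "(u, v, l) \<in> feas \<phi>" "(u', v', l') \<in> feas \<psi>" for u v l u' v' l' \<phi> \<psi>
  proof -
    have "\<phi> (i, j) + \<psi> (i, j) \<le> (u i + u' i) + (v j + v' j) + (l + l') * d i j" if "i \<in> I" "j \<in> I" for i j
    proof -
      have "\<phi> (i, j) \<le> u i + v j + l * d i j" "\<psi> (i, j) \<le> u' i + v' j + l' * d i j"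
        using \<open>(u, v, l) \<in> feas \<phi>\<close> \<open>(u', v', l') \<in> feas \<psi>\<close> that unfolding feas_def by blast+
      then show ?thesis by (simp add: algebra_simps)
    qed
    then show ?thesis using that unfolding feas_def by auto
  qed
  \<comment> \<open>A feasible point for a cost and one for its negative add up to a feasible point
    for 0, so the value of the first is at least minus the value of the second.\<close>
  have bdd: "bdd_below ((\<lambda>(u, v, l). obj u v l) ` feas \<phi>)" for \<phi>
  proof -
    obtain u' v' l' where *: "(u', v', l') \<in> feas (\<lambda>a. - \<phi> a)"
      using feas_ne[of "\<lambda>a. - \<phi> a"] by auto
    have "- obj u' v' l' \<le> obj u v l" if "(u, v, l) \<in> feas \<phi>" for u v l
      using nonneg feas_add[OF that *] obj_add[of u u' v v' l l'] by fastforce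
    then show ?thesis by (intro bdd_belowI2[where m = "- obj u' v' l'"]) auto
  qed
  have S_le: "S \<phi> \<le> obj u v l" if "(u, v, l) \<in> feas \<phi>" for \<phi> u v l
    unfolding S_def using cINF_lower[OF bdd that] by simp
  have S_ge: "c \<le> S \<phi>" if "\<And>u v l. (u, v, l) \<in> feas \<phi> \<Longrightarrow> c \<le> obj u v l" for \<phi> c
    unfolding S_def using feas_ne that by (intro cINF_greatest) auto
  have S_scale: "t * S \<phi> \<le> S (\<lambda>a. t * \<phi> a)" if t: "t > 0" for t \<phi>
  proof (rule S_ge)
    fix u v l assume "(u, v, l) \<in> feas (\<lambda>a. t * \<phi> a)"
    then have "((\<lambda>i. (1/t) * u i), (\<lambda>i. (1/t) * v i), (1/t) * l) \<in> feas \<phi>"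
      using t unfolding feas_def by (auto simp: field_simps)
    from S_le[OF this] have "S \<phi> \<le> (1/t) * obj u v l" unfolding obj_scale .
    then show "t * S \<phi> \<le> obj u v l" using t by (simp add: field_simps)
  qed
  have "\<exists>w. \<forall>\<phi>. (\<forall>a. a \<notin> I \<times> I \<longrightarrow> \<phi> a = 0) \<longrightarrow> (\<Sum>a\<in>I \<times> I. w a * \<phi> a) \<le> S \<phi>"
  proof (rule sublinear_dominates_linear)
    show "S (\<lambda>a. \<phi> a + \<psi> a) \<le> S \<phi> + S \<psi>" for \<phi> \<psi>
    proof -
      have "S (\<lambda>a. \<phi> a + \<psi> a) - S \<psi> \<le> S \<phi>"
      proof (rule S_ge)
        fix u v l assume 1: "(u, v, l) \<in> feas \<phi>"
        have "S (\<lambda>a. \<phi> a + \<psi> a) - obj u v l \<le> S \<psi>"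
        proof (rule S_ge)
          fix u' v' l' assume "(u', v', l') \<in> feas \<psi>"
          from S_le[OF feas_add[OF 1 this]]
          show "S (\<lambda>a. \<phi> a + \<psi> a) - obj u v l \<le> obj u' v' l'"
            unfolding obj_add by simp
        qed
        then show "S (\<lambda>a. \<phi> a + \<psi> a) - S \<psi> \<le> obj u v l" by simp
      qed
      then show ?thesis by simp
    qed
    show "S (\<lambda>a. t * \<phi> a) = t * S \<phi>" if t: "t > 0" for t \<phi>
    proof (rule antisym)
      have "(1/t) * S (\<lambda>a. t * \<phi> a) \<le> S (\<lambda>a. (1/t) * (t * \<phi> a))"
        using t by (intro S_scale) auto
      then show "S (\<lambda>a. t * \<phi> a) \<le> t * S \<phi>" using t by (simp add: field_simps)
    qed (rule S_scale[OF t])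
    show "S (\<lambda>a. 0) \<ge> 0" by (rule S_ge) (rule nonneg)
  qed (use fin in simp)
  then obtain w where w: "\<And>\<phi>. (\<forall>a. a \<notin> I \<times> I \<longrightarrow> \<phi> a = 0) \<Longrightarrow> (\<Sum>a\<in>I \<times> I. w a * \<phi> a) \<le> S \<phi>"
    by blast
  define P where "P i j = w (i, j)" for i j
  \<comment> \<open>Every property of the plan comes from testing the functional on a cost with an
    explicit dual certificate. The cost \<open>-1\<close> at a single pair gives nonnegativity; the
    cost \<open>t\<close> on one row or column, with \<open>t = 1\<close> and \<open>t = -1\<close>,
    gives the marginals; \<open>d\<close> itself with \<open>l = 1\<close> gives the bound
    \<open>D\<close>.\<close>
  have le: "(\<Sum>i\<in>I. \<Sum>j\<in>I. P i j * g i j) \<le> obj u v l"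
    if "0 \<le> l" "\<And>i j. i \<in> I \<Longrightarrow> j \<in> I \<Longrightarrow> g i j \<le> u i + v j + l * d i j" for g u v l
  proof -
    define \<phi> where "\<phi> a = (if a \<in> I \<times> I then g (fst a) (snd a) else 0)" for a
    have "(\<Sum>i\<in>I. \<Sum>j\<in>I. P i j * g i j) = (\<Sum>a\<in>I \<times> I. w a * \<phi> a)"
      by (auto simp: sum.cartesian_product P_def \<phi>_def intro!: sum.cong)
    also have "\<dots> \<le> S \<phi>" by (rule w) (auto simp: \<phi>_def)
    also have "\<dots> \<le> obj u v l"
      by (rule S_le) (use that in \<open>auto simp: feas_def \<phi>_def\<close>)
    finally show ?thesis .
  qed
  show thesis
  proof (rule that[of P])
    fix i0 j0 assume ij: "i0 \<in> I" "j0 \<in> I"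
    have "(\<Sum>i\<in>I. \<Sum>j\<in>I. P i j * (if i = i0 then if j = j0 then -1 else 0 else 0)) \<le> obj (\<lambda>_. 0) (\<lambda>_. 0) 0"
      by (rule le) auto
    moreover have "(\<Sum>i\<in>I. \<Sum>j\<in>I. P i j * (if i = i0 then if j = j0 then -1 else 0 else 0)) =
       (\<Sum>i\<in>I. if i = i0 then - P i0 j0 else 0)"
    proof (intro sum.cong refl)
      fix i assume "i \<in> I"
      have "(\<Sum>j\<in>I. P i j * (if i = i0 then if j = j0 then -1 else 0 else 0)) =
          (\<Sum>j\<in>I. if j = j0 then (if i = i0 then - P i0 j0 else 0) else 0)"
        by (intro sum.cong) auto
      then show "(\<Sum>j\<in>I. P i j * (if i = i0 then if j = j0 then -1 else 0 else 0)) =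
          (if i = i0 then - P i0 j0 else 0)"
        using fin ij by simp
    qed
    ultimately show "0 \<le> P i0 j0" using fin ij by (simp add: obj_def)
  next
    fix i0 assume i0: "i0 \<in> I"
    have "t * (\<Sum>j\<in>I. P i0 j) \<le> t * p i0" for t
    proof -
      have "(\<Sum>i\<in>I. \<Sum>j\<in>I. P i j * (if i = i0 then t else 0)) \<le> obj (\<lambda>i. if i = i0 then t else 0) (\<lambda>_. 0) 0"
        by (rule le) auto
      moreover have "(\<Sum>i\<in>I. \<Sum>j\<in>I. P i j * (if i = i0 then t else 0)) =
          (\<Sum>i\<in>I. if i = i0 then t * (\<Sum>j\<in>I. P i0 j) else 0)"
        by (intro sum.cong) (auto simp: sum_distrib_left mult.commute)
      ultimately show ?thesis
        using fin i0 by (simp add: obj_def if_distrib mult.commute cong: if_cong)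
    qed
    from this[of 1] this[of "-1"] show "(\<Sum>j\<in>I. P i0 j) = p i0" by simp
  next
    fix j0 assume j0: "j0 \<in> I"
    have "t * (\<Sum>i\<in>I. P i j0) \<le> t * q j0" for t
    proof -
      have "(\<Sum>i\<in>I. \<Sum>j\<in>I. P i j * (if j = j0 then t else 0)) \<le> obj (\<lambda>_. 0) (\<lambda>j. if j = j0 then t else 0) 0"
        by (rule le) auto
      moreover have "(\<Sum>j\<in>I. P i j * (if j = j0 then t else 0)) = t * P i j0" for i
      proof -
        have "(\<Sum>j\<in>I. P i j * (if j = j0 then t else 0)) = (\<Sum>j\<in>I. if j = j0 then t * P i j0 else 0)"
          by (intro sum.cong) auto
        then show ?thesis using fin j0 by simp
      qed
      ultimately show ?thesis
        using fin j0 by (simp add: obj_def if_distrib sum_distrib_left mult.commute[of t] cong: if_cong)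
    qed
    from this[of 1] this[of "-1"] show "(\<Sum>i\<in>I. P i j0) = q j0" by simp
  next
    show "(\<Sum>i\<in>I. \<Sum>j\<in>I. P i j * d i j) \<le> D"
      using le[of 1 d "\<lambda>_. 0" "\<lambda>_. 0"] by (simp add: obj_def)
  qed
qed

section \<open>From a finite transport plan to a coupling of measures\<close>

lemma coupling_of_finite_coupling:
  fixes P :: "'i \<Rightarrow> 'i \<Rightarrow> real"
  assumes M: "prob_space M" and M': "prob_space M'" and I: "finite I"
    and C: "\<And>i. i \<in> I \<Longrightarrow> C i \<in> sets M" "disjoint_family_on C I" "(\<Union>i\<in>I. C i) = space M"
    and D: "\<And>i. i \<in> I \<Longrightarrow> D i \<in> sets M'" "disjoint_family_on D I" "(\<Union>i\<in>I. D i) = space M'"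
    and P: "\<And>i j. i \<in> I \<Longrightarrow> j \<in> I \<Longrightarrow> 0 \<le> P i j"
    and row: "\<And>i. i \<in> I \<Longrightarrow> (\<Sum>j\<in>I. P i j) = measure M (C i)"
    and col: "\<And>j. j \<in> I \<Longrightarrow> (\<Sum>i\<in>I. P i j) = measure M' (D j)"
  obtains \<pi> where "prob_space \<pi>" "sets \<pi> = sets (M \<Otimes>\<^sub>M M')"
    "distr \<pi> M fst = M" "distr \<pi> M' snd = M'"
    "\<And>i j. i \<in> I \<Longrightarrow> j \<in> I \<Longrightarrow> measure \<pi> (C i \<times> D j) = P i j"
proof -
  interpret M: prob_space M by fact
  interpret M': prob_space M' by fact
  \<comment> \<open>Inside each product cell the coupling is a multiple of the product measure, of
    total mass \<open>P i j\<close>. Spreading the mass in this way, instead of placing it at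
    points, makes the marginals \<open>M\<close> and \<open>M'\<close> themselves and not
    discretised versions of them.\<close>
  define w where "w i j = P i j / (measure M (C i) * measure M' (D j))" for i j
  have w0: "0 \<le> w i j" if "i \<in> I" "j \<in> I" for i j
    unfolding w_def using P[OF that] by (intro divide_nonneg_nonneg) auto
  \<comment> \<open>A null cell makes the divisor in \<open>w\<close> zero, but then \<open>P\<close> vanishes there too.\<close>
  define g where "g z = (\<Sum>i\<in>I. \<Sum>j\<in>I. ennreal (w i j) * indicator (C i \<times> D j) z)" for z
  have g_meas: "g \<in> borel_measurable (M \<Otimes>\<^sub>M M')"
    unfolding g_def using C(1) D(1) by (intro borel_measurable_sum borel_measurable_times borel_measurable_indicator) auto
  define \<pi> where "\<pi> = density (M \<Otimes>\<^sub>M M') g"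
  have sets_\<pi>: "sets \<pi> = sets (M \<Otimes>\<^sub>M M')" by (simp add: \<pi>_def)
  have space_\<pi>: "space \<pi> = space M \<times> space M'" by (simp add: \<pi>_def space_pair_measure)
  have rect: "emeasure \<pi> (A \<times> B) = ennreal (\<Sum>i\<in>I. \<Sum>j\<in>I. w i j * (measure M (C i \<inter> A) * measure M' (D j \<inter> B)))"
    if A: "A \<in> sets M" and B: "B \<in> sets M'" for A B
  proof -
    have "emeasure \<pi> (A \<times> B) = (\<integral>\<^sup>+z. g z * indicator (A \<times> B) z \<partial>(M \<Otimes>\<^sub>M M'))"
      unfolding \<pi>_def using g_meas A B by (intro emeasure_density) auto
    also have "\<dots> = (\<integral>\<^sup>+z. (\<Sum>i\<in>I. \<Sum>j\<in>I. ennreal (w i j) * indicator ((C i \<inter> A) \<times> (D j \<inter> B)) z) \<partial>(M \<Otimes>\<^sub>M M'))"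
      unfolding g_def sum_distrib_right
      by (intro nn_integral_cong sum.cong refl) (auto simp: indicator_def)
    also have "\<dots> = (\<Sum>i\<in>I. \<Sum>j\<in>I. \<integral>\<^sup>+z. ennreal (w i j) * indicator ((C i \<inter> A) \<times> (D j \<inter> B)) z \<partial>(M \<Otimes>\<^sub>M M'))"
    proof -
      have meas: "(\<lambda>z. ennreal (w i j) * indicator ((C i \<inter> A) \<times> (D j \<inter> B)) z) \<in> borel_measurable (M \<Otimes>\<^sub>M M')"
        if "i \<in> I" "j \<in> I" for i j
      proof -
        have [measurable]: "(C i \<inter> A) \<times> (D j \<inter> B) \<in> sets (M \<Otimes>\<^sub>M M')"
          using that A B C(1) D(1) by auto
        show ?thesis by measurable
      qed
      have "(\<integral>\<^sup>+z. (\<Sum>i\<in>I. \<Sum>j\<in>I. ennreal (w i j) * indicator ((C i \<inter> A) \<times> (D j \<inter> B)) z) \<partial>(M \<Otimes>\<^sub>M M')) =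
          (\<Sum>i\<in>I. \<integral>\<^sup>+z. (\<Sum>j\<in>I. ennreal (w i j) * indicator ((C i \<inter> A) \<times> (D j \<inter> B)) z) \<partial>(M \<Otimes>\<^sub>M M'))"
        by (intro nn_integral_sum borel_measurable_sum meas)
      then show ?thesis by (simp add: nn_integral_sum meas)
    qed
    also have "\<dots> = (\<Sum>i\<in>I. \<Sum>j\<in>I. ennreal (w i j * (measure M (C i \<inter> A) * measure M' (D j \<inter> B))))"
    proof (intro sum.cong refl)
      fix i j assume "i \<in> I" "j \<in> I"
      then have "C i \<inter> A \<in> sets M" "D j \<inter> B \<in> sets M'" using A B C(1) D(1) by auto
      then have "(\<integral>\<^sup>+z. ennreal (w i j) * indicator ((C i \<inter> A) \<times> (D j \<inter> B)) z \<partial>(M \<Otimes>\<^sub>M M')) =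
          ennreal (w i j) * (emeasure M (C i \<inter> A) * emeasure M' (D j \<inter> B))"
        by (subst nn_integral_cmult_indicator) (auto simp: M'.emeasure_pair_measure_Times)
      then show "(\<integral>\<^sup>+z. ennreal (w i j) * indicator ((C i \<inter> A) \<times> (D j \<inter> B)) z \<partial>(M \<Otimes>\<^sub>M M')) =
          ennreal (w i j * (measure M (C i \<inter> A) * measure M' (D j \<inter> B)))"
        using w0[OF \<open>i \<in> I\<close> \<open>j \<in> I\<close>]
        by (simp add: M.emeasure_eq_measure M'.emeasure_eq_measure ennreal_mult)
    qed
    also have "\<dots> = ennreal (\<Sum>i\<in>I. \<Sum>j\<in>I. w i j * (measure M (C i \<inter> A) * measure M' (D j \<inter> B)))"
      using w0 by (simp add: sum_nonneg)
    finally show ?thesis .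
  qed
  have P_zero: "P i j = 0" if "i \<in> I" "j \<in> I" "measure M (C i) = 0 \<or> measure M' (D j) = 0" for i j
  proof -
    have "P i j \<le> (\<Sum>j\<in>I. P i j)" "P i j \<le> (\<Sum>i\<in>I. P i j)"
      using P that I by (auto intro: member_le_sum)
    then show ?thesis using row[OF that(1)] col[OF that(2)] that P[OF that(1,2)] by auto
  qed
  have cut: "(\<Sum>i\<in>I. measure M (C i \<inter> A)) = measure M A" if "A \<in> sets M" for A
  proof -
    have "measure M (\<Union>i\<in>I. C i \<inter> A) = (\<Sum>i\<in>I. measure M (C i \<inter> A))"
      using I C that by (intro M.finite_measure_finite_Union) (auto simp: disjoint_family_on_def)
    moreover have "(\<Union>i\<in>I. C i \<inter> A) = A" using C(3) sets.sets_into_space[OF that] by auto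
    ultimately show ?thesis by simp
  qed
  have cut': "(\<Sum>i\<in>I. measure M' (D i \<inter> A)) = measure M' A" if "A \<in> sets M'" for A
  proof -
    have "measure M' (\<Union>i\<in>I. D i \<inter> A) = (\<Sum>i\<in>I. measure M' (D i \<inter> A))"
      using I D that by (intro M'.finite_measure_finite_Union) (auto simp: disjoint_family_on_def)
    moreover have "(\<Union>i\<in>I. D i \<inter> A) = A" using D(3) sets.sets_into_space[OF that] by auto
    ultimately show ?thesis by simp
  qed
  have fst_marginal: "emeasure \<pi> (A \<times> space M') = emeasure M A" if A: "A \<in> sets M" for A
  proof -
    have "(\<Sum>j\<in>I. w i j * (measure M (C i \<inter> A) * measure M' (D j \<inter> space M'))) = measure M (C i \<inter> A)"
      if i: "i \<in> I" for i
    proof -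
      have "w i j * (measure M (C i \<inter> A) * measure M' (D j \<inter> space M')) =
          P i j * (measure M (C i \<inter> A) / measure M (C i))" if "j \<in> I" for j
        using P_zero[OF i that] sets.sets_into_space[OF D(1)[OF that]]
        by (cases "measure M' (D j) = 0") (auto simp: w_def Int_absorb2)
      then have "(\<Sum>j\<in>I. w i j * (measure M (C i \<inter> A) * measure M' (D j \<inter> space M'))) =
          (\<Sum>j\<in>I. P i j) * (measure M (C i \<inter> A) / measure M (C i))"
        by (simp add: sum_distrib_right sum_divide_distrib)
      also have "\<dots> = measure M (C i \<inter> A)"
        using M.finite_measure_mono[of "C i \<inter> A" "C i"] C(1)[OF i]
        by (cases "measure M (C i) = 0") (auto simp: row[OF i] measure_le_0_iff)
      finally show ?thesis .
    qed
    then show ?thesis using rect[OF A sets.top] cut[OF A] by (simp add: M.emeasure_eq_measure)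
  qed
  have snd_marginal: "emeasure \<pi> (space M \<times> B) = emeasure M' B" if B: "B \<in> sets M'" for B
  proof -
    have "(\<Sum>i\<in>I. w i j * (measure M (C i \<inter> space M) * measure M' (D j \<inter> B))) = measure M' (D j \<inter> B)"
      if j: "j \<in> I" for j
    proof -
      have "w i j * (measure M (C i \<inter> space M) * measure M' (D j \<inter> B)) =
          P i j * (measure M' (D j \<inter> B) / measure M' (D j))" if "i \<in> I" for i
        using P_zero[OF that j] sets.sets_into_space[OF C(1)[OF that]]
        by (cases "measure M (C i) = 0") (auto simp: w_def Int_absorb2)
      then have "(\<Sum>i\<in>I. w i j * (measure M (C i \<inter> space M) * measure M' (D j \<inter> B))) =
          (\<Sum>i\<in>I. P i j) * (measure M' (D j \<inter> B) / measure M' (D j))"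
        by (simp add: sum_distrib_right sum_divide_distrib)
      also have "\<dots> = measure M' (D j \<inter> B)"
        using M'.finite_measure_mono[of "D j \<inter> B" "D j"] D(1)[OF j]
        by (cases "measure M' (D j) = 0") (auto simp: col[OF j] measure_le_0_iff)
      finally show ?thesis .
    qed
    then have "(\<Sum>j\<in>I. \<Sum>i\<in>I. w i j * (measure M (C i \<inter> space M) * measure M' (D j \<inter> B))) = measure M' B"
      using cut'[OF B] by simp
    then show ?thesis
      using rect[OF sets.top B] by (subst (asm) sum.swap) (simp add: M'.emeasure_eq_measure)
  qed
  have distr_fst: "distr \<pi> M fst = M"
  proof (rule measure_eqI)
    fix A assume "A \<in> sets (distr \<pi> M fst)"
    then have A: "A \<in> sets M" by simp
    have "fst -` A \<inter> space \<pi> = A \<times> space M'" using sets.sets_into_space[OF A] by (auto simp: space_\<pi>)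
    moreover have "fst \<in> measurable \<pi> M" using measurable_cong_sets[OF sets_\<pi> refl] by auto
    ultimately show "emeasure (distr \<pi> M fst) A = emeasure M A"
      using A by (simp add: emeasure_distr fst_marginal)
  qed simp
  have distr_snd: "distr \<pi> M' snd = M'"
  proof (rule measure_eqI)
    fix A assume "A \<in> sets (distr \<pi> M' snd)"
    then have A: "A \<in> sets M'" by simp
    have "snd -` A \<inter> space \<pi> = space M \<times> A" using sets.sets_into_space[OF A] by (auto simp: space_\<pi>)
    moreover have "snd \<in> measurable \<pi> M'" using measurable_cong_sets[OF sets_\<pi> refl] by auto
    ultimately show "emeasure (distr \<pi> M' snd) A = emeasure M' A"
      using A by (simp add: emeasure_distr snd_marginal)
  qed simp
  have prob: "prob_space \<pi>"
    by (rule prob_spaceI) (simp add: space_\<pi> fst_marginal M.emeasure_space_1)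
  have cell: "measure \<pi> (C a \<times> D b) = P a b" if ab: "a \<in> I" "b \<in> I" for a b
  proof -
    have "(\<Sum>i\<in>I. \<Sum>j\<in>I. w i j * (measure M (C i \<inter> C a) * measure M' (D j \<inter> D b))) =
        (\<Sum>i\<in>I. if i = a then (\<Sum>j\<in>I. if j = b then P a b else 0) else 0)"
    proof (intro sum.cong refl)
      fix i assume i: "i \<in> I"
      show "(\<Sum>j\<in>I. w i j * (measure M (C i \<inter> C a) * measure M' (D j \<inter> D b))) =
          (if i = a then (\<Sum>j\<in>I. if j = b then P a b else 0) else 0)"
      proof (cases "i = a")
        case True
        have "w a j * (measure M (C a) * measure M' (D j \<inter> D b)) = (if j = b then P a b else 0)" if j: "j \<in> I" for j
        proof (cases "j = b")
          case True
          then show ?thesis using P_zero[OF ab] by (auto simp: w_def)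
        next
          case False
          then have "D j \<inter> D b = {}" using D(2) j ab by (auto simp: disjoint_family_on_def)
          then show ?thesis using False by simp
        qed
        then show ?thesis using True by (auto intro!: sum.cong)
      next
        case False
        then have "C i \<inter> C a = {}" using C(2) i ab by (auto simp: disjoint_family_on_def)
        then show ?thesis using False by simp
      qed
    qed
    also have "\<dots> = P a b" using I ab by simp
    finally show ?thesis
      using rect[OF C(1)[OF ab(1)] D(1)[OF ab(2)]] P[OF ab] by (simp add: measure_def)
  qed
  show thesis by (rule that[OF prob sets_\<pi> distr_fst distr_snd cell])
qed

section \<open>Fourier analysis on a finite grid\<close>

lemma hvec_nth [simp]: "hvec h $ i = of_int (h $ i)"
  by (simp add: hvec_def)

lemma hvec_add: "hvec (x + y) = hvec x + hvec y"
  and hvec_diff: "hvec (x - y) = hvec x - hvec y"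
  and hvec_minus: "hvec (- x) = - hvec x"
  and hvec_zero [simp]: "hvec 0 = 0"
  by (simp_all add: vec_eq_iff)

lemma inner_hvec: "hvec h \<bullet> hvec x = of_int (\<Sum>i\<in>UNIV. h $ i * x $ i)"
  by (simp add: inner_vec_def)

lemma finite_int_box: "finite {x :: int^'n. \<forall>i. a \<le> x $ i \<and> x $ i \<le> b}"
proof (rule finite_subset)
  show "{x :: int^'n. \<forall>i. a \<le> x $ i \<and> x $ i \<le> b} \<subseteq> (\<lambda>f. \<chi> i. f i) ` (UNIV \<rightarrow>\<^sub>E {a..b})"
  proof
    fix x :: "int^'n" assume "x \<in> {x. \<forall>i. a \<le> x $ i \<and> x $ i \<le> b}"
    then have "(\<lambda>i. x $ i) \<in> UNIV \<rightarrow>\<^sub>E {a..b}" by auto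
    moreover have "x = (\<chi> i. x $ i)" by simp
    ultimately show "x \<in> (\<lambda>f. \<chi> i. f i) ` (UNIV \<rightarrow>\<^sub>E {a..b})" by blast
  qed
  show "finite ((\<lambda>f. \<chi> i. f i) ` (UNIV \<rightarrow>\<^sub>E {a..b}) :: (int^'n) set)"
    by (intro finite_imageI finite_PiE) auto
qed

text \<open>Functions on \<open>(Z/N)^k\<close> are encoded as functions on all of
  \<open>int^'n\<close> that are invariant under \<open>gmod N\<close>, with \<open>grid N\<close>
  as set of representatives. Translations and Lipschitz conditions then need no wrap-around. A
  vector \<open>x\<close> stands for the torus point \<open>x / N\<close>.\<close>

definition grid :: "nat \<Rightarrow> (int^'n) set" where
  "grid N = {x. \<forall>i. 0 \<le> x $ i \<and> x $ i < int N}"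

definition gmod :: "nat \<Rightarrow> int^'n \<Rightarrow> int^'n" where
  "gmod N x = (\<chi> i. x $ i mod int N)"

definition gavg :: "nat \<Rightarrow> (int^'n \<Rightarrow> 'a::field_char_0) \<Rightarrow> 'a" where
  "gavg N \<phi> = (\<Sum>x\<in>grid N. \<phi> x) / of_nat (card (grid N :: (int^'n) set))"

definition echar :: "nat \<Rightarrow> int^'n \<Rightarrow> int^'n \<Rightarrow> complex" where
  "echar N h x = cis (2 * pi * (hvec h \<bullet> hvec x) / real N)"

definition freqs :: "nat \<Rightarrow> (int^'n) set" where
  "freqs m = {h. \<forall>i. \<bar>h $ i\<bar> \<le> int m}"

lemma finite_grid [simp]: "finite (grid N)"
  by (rule finite_subset[OF _ finite_int_box[of 0 "int N"]]) (auto simp: grid_def less_imp_le)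

lemma finite_freqs [simp]: "finite (freqs m)"
  by (rule finite_subset[OF _ finite_int_box[of "- int m" "int m"]]) (auto simp: freqs_def abs_le_iff minus_le_iff)

lemma card_grid_pos:
  assumes "N > 0" shows "card (grid N :: (int^'n) set) > 0"
proof -
  have "(0 :: int^'n) \<in> grid N" using assms by (simp add: grid_def)
  then show ?thesis by (auto simp: card_gt_0_iff)
qed

lemma gmod_in_grid: "N > 0 \<Longrightarrow> gmod N x \<in> grid N"
  by (simp add: gmod_def grid_def)

lemma gmod_grid: "x \<in> grid N \<Longrightarrow> gmod N x = x"
  by (simp add: gmod_def grid_def vec_eq_iff)

lemma gmod_diff_gmod: "gmod N (x - gmod N y) = gmod N (x - y)"
  and gmod_add_gmod: "gmod N (gmod N y + x) = gmod N (y + x)"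
  by (simp_all add: gmod_def vec_eq_iff mod_diff_right_eq mod_add_left_eq)

lemma gmod_idem [simp]: "gmod N (gmod N x) = gmod N x"
  by (simp add: gmod_def)

lemma gavg_reflect:
  assumes N: "N > 0" and per: "\<And>y. \<phi> (gmod N y) = \<phi> y"
  shows "gavg N (\<lambda>y. \<phi> (x - y)) = gavg N \<phi>"
proof -
  have "(\<Sum>y\<in>grid N. \<phi> (x - y)) = (\<Sum>y\<in>grid N. \<phi> y)"
  proof (rule sum.reindex_bij_witness[where i = "\<lambda>y. gmod N (x - y)" and j = "\<lambda>y. gmod N (x - y)"])
    fix y :: "int^'a" assume y: "y \<in> grid N"
    show "gmod N (x - gmod N (x - y)) = y" by (simp add: gmod_diff_gmod gmod_grid y)
    then show "gmod N (x - gmod N (x - y)) = y" .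
    show "\<phi> (gmod N (x - y)) = \<phi> (x - y)" by (rule per)
  qed (use N gmod_in_grid in auto)
  then show ?thesis by (simp add: gavg_def)
qed

lemma gavg_shift:
  assumes N: "N > 0" and per: "\<And>y. \<phi> (gmod N y) = \<phi> y"
  shows "gavg N (\<lambda>y. \<phi> (y + a)) = gavg N \<phi>"
proof -
  have *: "gmod N (gmod N (y + b) - b) = y" "gmod N (gmod N (y - b) + b) = y" if "y \<in> grid N" for y b :: "int^'a"
    using gmod_add_gmod[of N "y + b" "- b"] gmod_add_gmod[of N "y - b" "b"] that by (simp_all add: gmod_grid)
  have "(\<Sum>y\<in>grid N. \<phi> (y + a)) = (\<Sum>y\<in>grid N. \<phi> y)"
    by (rule sum.reindex_bij_witness[where i = "\<lambda>y. gmod N (y - a)" and j = "\<lambda>y. gmod N (y + a)"])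
       (use N gmod_in_grid * per in auto)
  then show ?thesis by (simp add: gavg_def)
qed

lemma gavg_cmult: "gavg N (\<lambda>y. c * \<phi> y) = c * gavg N \<phi>"
  by (simp add: gavg_def sum_distrib_left)

lemma gavg_sum: "gavg N (\<lambda>y. \<Sum>a\<in>A. \<phi> a y) = (\<Sum>a\<in>A. gavg N (\<phi> a))"
proof -
  have "(\<Sum>x\<in>grid N. \<Sum>a\<in>A. \<phi> a x) = (\<Sum>a\<in>A. \<Sum>x\<in>grid N. \<phi> a x)" by (rule sum.swap)
  then show ?thesis by (simp add: gavg_def sum_divide_distrib)
qed

lemma gavg_add: "gavg N (\<lambda>y. \<phi> y + \<psi> y) = gavg N \<phi> + gavg N \<psi>"
  and gavg_diff: "gavg N (\<lambda>y. \<phi> y - \<psi> y) = gavg N \<phi> - gavg N \<psi>"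
  by (simp_all add: gavg_def sum.distrib add_divide_distrib sum_subtractf diff_divide_distrib)

lemma gavg_const: "N > 0 \<Longrightarrow> gavg N (\<lambda>y :: int^'n. c) = c"
  using card_grid_pos[of N, where ?'n = 'n] by (simp add: gavg_def card_gt_0_iff)

lemma gavg_of_real: "gavg N (\<lambda>y. of_real (\<phi> y) :: complex) = of_real (gavg N \<phi>)"
  by (simp add: gavg_def)

lemma gavg_mono: "(\<And>y. y \<in> grid N \<Longrightarrow> \<phi> y \<le> \<psi> y) \<Longrightarrow> gavg N \<phi> \<le> (gavg N \<psi> :: real)"
  unfolding gavg_def by (intro divide_right_mono sum_mono) auto

lemma norm_gavg_le: "norm (gavg N \<phi>) \<le> gavg N (\<lambda>y. norm (\<phi> y))"
  for \<phi> :: "int^'n \<Rightarrow> 'a :: {real_normed_field, field_char_0}"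
  unfolding gavg_def norm_divide by (auto intro: divide_right_mono norm_sum)

lemma norm_echar [simp]: "norm (echar N h x) = 1"
  by (simp add: echar_def)

lemma echar_add_left: "echar N (h + l) x = echar N h x * echar N l x"
  and echar_add_right: "echar N h (x + y) = echar N h x * echar N h y"
  by (simp_all add: echar_def hvec_add inner_add_left inner_add_right cis_mult add_divide_distrib algebra_simps)

lemma echar_diff_right: "echar N h (x - y) = echar N h x * echar N (- h) y"
  by (simp add: echar_def hvec_diff hvec_minus inner_diff_right cis_mult diff_divide_distrib algebra_simps)

lemma cnj_echar: "cnj (echar N h x) = echar N (- h) x"
  by (simp add: echar_def hvec_minus cis_cnj)

lemma echar_zero [simp]: "echar N 0 x = 1" "echar N h 0 = 1"
  by (simp_all add: echar_def)

lemma echar_eq_1: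
  assumes "N > 0" "\<And>i. int N dvd h $ i * x $ i"
  shows "echar N h x = 1"
proof -
  have "int N dvd (\<Sum>i\<in>UNIV. h $ i * x $ i)" using assms by (intro dvd_sum) auto
  then obtain n where n: "(\<Sum>i\<in>UNIV. h $ i * x $ i) = int N * n" by blast
  have "hvec h \<bullet> hvec x = real N * of_int n" by (simp add: inner_hvec n)
  then have "2 * pi * (hvec h \<bullet> hvec x) / real N = 2 * pi * of_int n" using assms(1) by simp
  then show ?thesis by (simp only: echar_def cis_multiple_2pi Ints_of_int)
qed

lemma echar_gmod [simp]:
  assumes "N > 0" shows "echar N h (gmod N x) = echar N h x"
proof -
  have "echar N h (x - gmod N x) = 1"
    using assms by (intro echar_eq_1) (auto simp: gmod_def mod_eq_dvd_iff[symmetric])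
  then show ?thesis
    using echar_add_right[of N h "x - gmod N x" "gmod N x"] by simp
qed

text \<open>Translation by a unit vector in a direction \<open>i\<close> where N does not divide
  \<open>h $ i\<close> multiplies the average by a root of unity other than 1, while translation
  invariance leaves it unchanged; so it is 0.\<close>

lemma gavg_echar:
  fixes h :: "int^'n"
  assumes N: "N > 0"
  shows "gavg N (echar N h) = (if \<forall>i. int N dvd h $ i then 1 else 0)"
proof (cases "\<forall>i. int N dvd h $ i")
  case True
  then have "echar N h = (\<lambda>x. 1)" using N by (auto intro!: echar_eq_1)
  then show ?thesis using True N by (simp add: gavg_const)
next
  case False
  then obtain i where i: "\<not> int N dvd h $ i" by blast
  define e :: "int^'n" where "e = axis i 1"
  have "hvec h \<bullet> hvec e = of_int (h $ i)"
    by (simp add: inner_hvec e_def axis_def if_distrib cong: if_cong)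
  then have ee: "echar N h e = cis (2 * pi * of_int (h $ i) / real N)" by (simp add: echar_def)
  have "echar N h e \<noteq> 1"
  proof
    assume "echar N h e = 1"
    then have "cos (2 * pi * of_int (h $ i) / real N) = 1"
      unfolding ee by (metis cis.sel(1) one_complex.sel(1))
    then obtain n :: int where "2 * pi * of_int (h $ i) / real N = of_int n * 2 * pi"
      using cos_one_2pi_int by blast
    then have "real_of_int (h $ i) = of_int (int N * n)" using N by (simp add: field_simps)
    then have "h $ i = int N * n" by (simp only: of_int_eq_iff)
    with i show False by simp
  qed
  moreover have "gavg N (echar N h) = echar N h e * gavg N (echar N h)"
  proof -
    have "gavg N (echar N h) = gavg N (\<lambda>x. echar N h (x + e))"
      using N by (intro gavg_shift[symmetric]) auto
    also have "\<dots> = gavg N (\<lambda>x. echar N h e * echar N h x)"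
      by (simp add: echar_add_right mult.commute)
    finally show ?thesis by (simp add: gavg_cmult)
  qed
  ultimately have "gavg N (echar N h) = 0" by simp
  then show ?thesis using False by simp
qed

text \<open>The assumption \<open>inc\<close> excludes aliasing: frequencies congruent modulo N give
  the same character on the grid, so orthogonality is available only between incongruent
  ones.\<close>

lemma gavg_parseval:
  fixes b :: "int^'n \<Rightarrow> complex"
  assumes N: "N > 0" and H: "finite H"
    and inc: "\<And>h l. h \<in> H \<Longrightarrow> l \<in> H \<Longrightarrow> (\<forall>i. int N dvd (h - l) $ i) \<Longrightarrow> h = l"
  shows "gavg N (\<lambda>x. (cmod (\<Sum>h\<in>H. b h * echar N h x))\<^sup>2) = (\<Sum>h\<in>H. (cmod (b h))\<^sup>2)"
proof -
  have "complex_of_real (gavg N (\<lambda>x. (cmod (\<Sum>h\<in>H. b h * echar N h x))\<^sup>2)) =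
      gavg N (\<lambda>x. (\<Sum>h\<in>H. b h * echar N h x) * cnj (\<Sum>l\<in>H. b l * echar N l x))"
    unfolding gavg_of_real[symmetric] complex_norm_square by simp
  also have "\<dots> = gavg N (\<lambda>x. \<Sum>h\<in>H. \<Sum>l\<in>H. (b h * cnj (b l)) * echar N (h - l) x)"
    by (simp add: sum_product cnj_echar diff_conv_add_uminus echar_add_left ac_simps del: add_uminus_conv_diff)
  also have "\<dots> = (\<Sum>h\<in>H. \<Sum>l\<in>H. (b h * cnj (b l)) * gavg N (echar N (h - l)))"
    by (simp add: gavg_sum gavg_cmult)
  also have "\<dots> = (\<Sum>h\<in>H. \<Sum>l\<in>H. if l = h then b h * cnj (b h) else 0)"
    by (intro sum.cong refl) (use inc in \<open>auto simp: gavg_echar N\<close>)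
  also have "\<dots> = complex_of_real (\<Sum>h\<in>H. (cmod (b h))\<^sup>2)"
    using H unfolding of_real_sum complex_norm_square by simp
  finally show ?thesis by (simp only: of_real_eq_iff)
qed

section \<open>The smoothing kernel\<close>

text \<open>The kernel is a tensor power of Fejer's extremal polynomial, which maximises the first
  coefficient among nonnegative trigonometric polynomials of degree m with mean 1. Being the squared
  modulus of a polynomial with nonnegative coefficients, it is nonnegative and has nonnegative
  coefficients itself. One choice of \<open>\<kappa>\<close> serves all N, which later allows bounds
  uniform in N.\<close>

lemma jackson_kernel_coefficients:
  fixes m :: nat
  obtains \<kappa> :: "int^'n \<Rightarrow> real" where
    "\<And>h. 0 \<le> \<kappa> h" "\<And>h. h \<notin> freqs m \<Longrightarrow> \<kappa> h = 0" "\<kappa> 0 = 1"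
    "\<And>i. \<kappa> (axis i 1) + \<kappa> (- axis i 1) = 2 * cos (pi / (real m + 2))"
    "\<And>N y. \<exists>r\<ge>0. (\<Sum>h\<in>freqs m. of_real (\<kappa> h) * echar N h y) = complex_of_real r"
proof -
  define \<theta> where "\<theta> = pi / (real m + 2)"
  define \<alpha> where "\<alpha> n = (if 0 \<le> n \<and> n \<le> int m then sin ((of_int n + 1) * \<theta>) else 0)" for n :: int
  define A where "A j = (\<Prod>i\<in>UNIV. \<alpha> (j $ i))" for j :: "int^'n"
  define J where "J = {j :: int^'n. \<forall>i. 0 \<le> j $ i \<and> j $ i \<le> int m}"
  define Q where "Q = (\<Sum>j\<in>J. (A j)\<^sup>2)"
  \<comment> \<open>\<open>\<alpha>\<close> is the top eigenvector of the path with \<open>m + 1\<close> vertices; \<open>\<kappa>\<close> are the coefficients of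
    \<open>\<bar>\<Sum>\<^sub>j A\<^sub>j e(j y)\<bar>\<^sup>2 / Q\<close>.\<close>
  define \<kappa> where "\<kappa> h = (\<Sum>j\<in>J. A j * A (j - h)) / Q" for h
  have finJ: "finite J" unfolding J_def by (rule finite_int_box)
  have \<alpha>_pos: "0 < \<alpha> n" if "0 \<le> n" "n \<le> int m" for n
  proof -
    have "(real_of_int n + 1) * \<theta> < (real m + 2) * \<theta>"
      using that by (intro mult_strict_right_mono) (auto simp: \<theta>_def)
    also have "\<dots> = pi" by (simp add: \<theta>_def)
    finally show ?thesis
      using that by (auto simp: \<alpha>_def \<theta>_def intro!: sin_gt_zero)
  qed
  \<comment> \<open>The angle \<open>\<theta>\<close> is chosen so that
    \<open>sin ((n + 1) * \<theta>)\<close> vanishes at \<open>n = -1\<close> and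
    \<open>n = m + 1\<close>. The zero extension of \<open>\<alpha>\<close> thus agrees with the
    sine one step beyond each end, and the addition formulas apply up to the boundary.\<close>
  have \<alpha>_rec: "\<alpha> (n + 1) + \<alpha> (n - 1) = 2 * cos \<theta> * \<alpha> n" if n: "0 \<le> n" "n \<le> int m" for n
  proof -
    have top: "\<alpha> (n + 1) = sin ((of_int n + 1) * \<theta> + \<theta>)"
    proof (cases "n = int m")
      case True
      then have "(of_int n + 1) * \<theta> + \<theta> = (real m + 2) * \<theta>" by (simp add: algebra_simps)
      also have "\<dots> = pi" by (simp add: \<theta>_def)
      finally have "(of_int n + 1) * \<theta> + \<theta> = pi" .
      then show ?thesis using True by (simp add: \<alpha>_def)
    next
      case False
      then show ?thesis using n by (simp add: \<alpha>_def algebra_simps)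
    qed
    have bot: "\<alpha> (n - 1) = sin ((of_int n + 1) * \<theta> - \<theta>)"
      using n by (cases "n = 0") (auto simp: \<alpha>_def algebra_simps)
    show ?thesis unfolding top bot sin_add sin_diff using n by (simp add: \<alpha>_def)
  qed
  have diff_freqs: "j - l \<in> freqs m" if "j \<in> J" "l \<in> J" for j l
  proof -
    have "\<bar>(j - l) $ i\<bar> \<le> int m" for i
    proof -
      have "0 \<le> j $ i" "j $ i \<le> int m" "0 \<le> l $ i" "l $ i \<le> int m" using that by (auto simp: J_def)
      then show ?thesis by simp
    qed
    then show ?thesis by (simp add: freqs_def)
  qed
  have A_nonneg: "0 \<le> A j" for j
    unfolding A_def by (intro prod_nonneg) (use \<alpha>_pos in \<open>auto simp: \<alpha>_def less_imp_le\<close>)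
  have A_pos: "0 < A j" if "j \<in> J" for j
    unfolding A_def by (intro prod_pos) (use \<alpha>_pos that in \<open>auto simp: J_def\<close>)
  have A_out: "A j = 0" if "j \<notin> J" for j
  proof -
    obtain i where "\<not> (0 \<le> j $ i \<and> j $ i \<le> int m)" using \<open>j \<notin> J\<close> by (auto simp: J_def)
    then have "\<alpha> (j $ i) = 0" unfolding \<alpha>_def by (rule if_not_P)
    then show ?thesis unfolding A_def by (intro prod_zero) auto
  qed
  \<comment> \<open>A shift along one axis changes a single factor of the product, so the
    eigenvector relation of \<open>\<alpha>\<close> passes to \<open>A\<close> with the same
    eigenvalue \<open>2 * cos \<theta>\<close>.\<close>
  have A_rec: "A (j - axis i 1) + A (j + axis i 1) = 2 * cos \<theta> * A j" if "j \<in> J" for i j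
  proof -
    define R where "R = (\<Prod>i'\<in>UNIV - {i}. \<alpha> (j $ i'))"
    have split: "A (j + c *s axis i 1) = \<alpha> (j $ i + c) * R" for c
    proof -
      have "(\<Prod>i'\<in>UNIV - {i}. \<alpha> ((j + c *s axis i 1) $ i')) = R"
        unfolding R_def by (intro prod.cong) (auto simp: axis_def)
      then show ?thesis unfolding A_def by (subst prod.remove[of _ i]) (auto simp: axis_def)
    qed
    have minus_axis: "j + (-1) *s axis i 1 = j - axis i 1" by (simp add: vec_eq_iff)
    have "A (j + axis i 1) = \<alpha> (j $ i + 1) * R" "A (j - axis i 1) = \<alpha> (j $ i - 1) * R" and Aj: "A j = \<alpha> (j $ i) * R"
      using split[of 1] split[of "-1"] split[of 0] by (simp_all add: minus_axis)
    then have "A (j - axis i 1) + A (j + axis i 1) = (\<alpha> (j $ i + 1) + \<alpha> (j $ i - 1)) * R"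
      by (simp add: algebra_simps)
    also have "\<dots> = 2 * cos \<theta> * \<alpha> (j $ i) * R" using \<alpha>_rec[of "j $ i"] that by (simp add: J_def)
    finally show ?thesis by (simp add: Aj)
  qed
  have Q: "Q > 0"
  proof -
    have "0 \<in> J" by (simp add: J_def)
    then show ?thesis unfolding Q_def
      using finJ A_pos[of 0] by (intro sum_pos2[of _ 0]) auto
  qed
  show thesis
  proof (rule that[of \<kappa>])
    show "0 \<le> \<kappa> h" for h
      unfolding \<kappa>_def using Q A_nonneg by (intro divide_nonneg_pos sum_nonneg mult_nonneg_nonneg) auto
    show "\<kappa> h = 0" if "h \<notin> freqs m" for h
    proof -
      have "A (j - h) = 0" if j: "j \<in> J" for j
      proof (rule A_out)
        show "j - h \<notin> J"
        proof
          assume "j - h \<in> J"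
          from diff_freqs[OF j this] have "h \<in> freqs m" by simp
          with \<open>h \<notin> freqs m\<close> show False by simp
        qed
      qed
      then show ?thesis by (simp add: \<kappa>_def)
    qed
    show "\<kappa> 0 = 1" using Q by (simp add: \<kappa>_def Q_def power2_eq_square)
    show "\<kappa> (axis i 1) + \<kappa> (- axis i 1) = 2 * cos (pi / (real m + 2))" for i
    proof -
      have "\<kappa> (axis i 1) + \<kappa> (- axis i 1) = (\<Sum>j\<in>J. A j * (A (j - axis i 1) + A (j + axis i 1))) / Q"
        by (simp add: \<kappa>_def add_divide_distrib sum.distrib algebra_simps)
      also have "(\<Sum>j\<in>J. A j * (A (j - axis i 1) + A (j + axis i 1))) = (\<Sum>j\<in>J. 2 * cos \<theta> * (A j)\<^sup>2)"
        by (intro sum.cong) (simp_all add: A_rec power2_eq_square)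
      also have "\<dots> = 2 * cos \<theta> * Q" by (simp add: Q_def sum_distrib_left)
      finally show ?thesis using Q by (simp add: \<theta>_def)
    qed
    show "\<exists>r\<ge>0. (\<Sum>h\<in>freqs m. of_real (\<kappa> h) * echar N h y) = complex_of_real r" for N y
    proof (intro exI conjI)
      let ?Z = "\<Sum>j\<in>J. of_real (A j) * echar N j y"
      show "0 \<le> (cmod ?Z)\<^sup>2 / Q" using Q by simp
      \<comment> \<open>Substitution \<open>h = j - l\<close>. Frequencies that are not of this form
        contribute nothing, because \<open>A\<close> vanishes outside \<open>J\<close>.\<close>
      have inner: "(\<Sum>h\<in>freqs m. of_real (A j * A (j - h)) * echar N h y) =
          (\<Sum>l\<in>J. of_real (A j * A l) * echar N (j - l) y)" if j: "j \<in> J" for j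
      proof -
        have "(\<Sum>h\<in>freqs m. of_real (A j * A (j - h)) * echar N h y) =
            (\<Sum>h\<in>(\<lambda>l. j - l) ` J. of_real (A j * A (j - h)) * echar N h y)"
        proof (rule sum.mono_neutral_right)
          show "(\<lambda>l. j - l) ` J \<subseteq> freqs m"
            using j diff_freqs by auto
          show "\<forall>h\<in>freqs m - (\<lambda>l. j - l) ` J. complex_of_real (A j * A (j - h)) * echar N h y = 0"
          proof
            fix h assume h: "h \<in> freqs m - (\<lambda>l. j - l) ` J"
            have "j - h \<notin> J"
            proof
              assume "j - h \<in> J"
              then have "j - (j - h) \<in> (\<lambda>l. j - l) ` J" by (rule imageI)
              with h show False by simp
            qed
            then show "complex_of_real (A j * A (j - h)) * echar N h y = 0" by (simp add: A_out)
          qed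
        qed simp
        also have "\<dots> = (\<Sum>l\<in>J. of_real (A j * A l) * echar N (j - l) y)"
          by (subst sum.reindex) (auto simp: inj_on_def)
        finally show ?thesis .
      qed
      have "(\<Sum>h\<in>freqs m. of_real (\<kappa> h) * echar N h y) =
          (\<Sum>h\<in>freqs m. \<Sum>j\<in>J. of_real (A j * A (j - h)) * echar N h y) / of_real Q"
        by (simp add: \<kappa>_def sum_divide_distrib sum_distrib_right)
      also have "(\<Sum>h\<in>freqs m. \<Sum>j\<in>J. of_real (A j * A (j - h)) * echar N h y) =
          (\<Sum>j\<in>J. \<Sum>l\<in>J. of_real (A j * A l) * echar N (j - l) y)"
        by (subst sum.swap) (intro sum.cong refl inner)
      also have "\<dots> = ?Z * cnj ?Z"
        by (simp add: sum_product cnj_echar diff_conv_add_uminus echar_add_left ac_simps del: add_uminus_conv_diff)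
      also have "\<dots> = of_real ((cmod ?Z)\<^sup>2)" by (rule complex_norm_square[symmetric])
      finally show "(\<Sum>h\<in>freqs m. of_real (\<kappa> h) * echar N h y) = complex_of_real ((cmod ?Z)\<^sup>2 / Q)" by simp
    qed
  qed
qed

text \<open>Averaging against a character extracts one coefficient as long as no other frequency
  aliases to it: the entries of \<open>h + l\<close> have absolute value at most
  \<open>m + 1\<close>, which is below N.\<close>

lemma gavg_jackson_kernel:
  fixes \<kappa> :: "int^'n \<Rightarrow> real"
  assumes N: "N > m + 1" and out: "\<And>h. h \<notin> freqs m \<Longrightarrow> \<kappa> h = 0"
    and l: "\<And>i. \<bar>l $ i\<bar> \<le> 1"
  shows "gavg N (\<lambda>y. echar N l y * (\<Sum>h\<in>freqs m. of_real (\<kappa> h) * echar N h y)) = of_real (\<kappa> (- l))"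
proof -
  have "gavg N (\<lambda>y. echar N l y * (\<Sum>h\<in>freqs m. of_real (\<kappa> h) * echar N h y)) =
      (\<Sum>h\<in>freqs m. of_real (\<kappa> h) * gavg N (echar N (h + l)))"
    by (simp add: sum_distrib_left gavg_sum gavg_cmult echar_add_left mult_ac flip: gavg_cmult)
  also have "\<dots> = (\<Sum>h\<in>freqs m. if h = - l then of_real (\<kappa> (- l)) else 0)"
  proof (intro sum.cong refl)
    fix h :: "int^'n" assume h: "h \<in> freqs m"
    have "h = - l" if *: "\<forall>i. int N dvd (h + l) $ i"
    proof -
      have "(h + l) $ i = 0" for i
      proof (rule ccontr)
        assume "(h + l) $ i \<noteq> 0"
        from dvd_imp_le_int[OF this, of "int N"] * have "int N \<le> \<bar>(h + l) $ i\<bar>" by simp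
        moreover have "\<bar>h $ i\<bar> \<le> int m" using h by (simp add: freqs_def)
        ultimately show False using l[of i] N by simp
      qed
      then show ?thesis by (simp add: vec_eq_iff eq_neg_iff_add_eq_0)
    qed
    then have "(\<forall>i. int N dvd (h + l) $ i) \<longleftrightarrow> h = - l" by auto
    moreover have "N > 0" using N by simp
    ultimately have "gavg N (echar N (h + l)) = (if h = - l then 1 else 0)"
      by (simp only: gavg_echar)
    then show "of_real (\<kappa> h) * gavg N (echar N (h + l)) = (if h = - l then of_real (\<kappa> (- l)) else 0 :: complex)"
      by simp
  qed
  also have "\<dots> = of_real (\<kappa> (- l))" using out by simp
  finally show ?thesis .
qed

section \<open>Gradient bound from grid increments\<close>

lemma norm_power2_vec: "(norm (x :: real^'n))\<^sup>2 = (\<Sum>i\<in>UNIV. (x $ i)\<^sup>2)"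
  unfolding power2_norm_eq_inner inner_vec_def by (simp add: power2_eq_square)

lemma norm_vec_le_sqrt_card:
  fixes x :: "real^'n"
  assumes "\<And>i. \<bar>x $ i\<bar> \<le> c"
  shows "norm x \<le> sqrt (real CARD('n)) * c"
proof -
  have c: "0 \<le> c" using assms[of undefined] by linarith
  have "(norm x)\<^sup>2 \<le> (\<Sum>i\<in>(UNIV :: 'n set). c\<^sup>2)"
    unfolding norm_power2_vec using assms c by (intro sum_mono) (simp add: abs_le_square_iff[symmetric])
  also have "\<dots> = (sqrt (real CARD('n)) * c)\<^sup>2" by (simp add: power_mult_distrib)
  finally show ?thesis by (rule power2_le_imp_le) (use c in simp)
qed

text \<open>\<open>G\<close> stands for the gradient of a trigonometric polynomial at one point,
  known only through increments along vectors \<open>v / N\<close> with a quadratic error. A step of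
  length \<open>s\<close> in a direction \<open>u\<close> is rounded to the grid: \<open>s\<close>
  is small enough to tame the quadratic term, and \<open>fine\<close> makes the rounding error small
  relative to \<open>s\<close>. This bounds \<open>G\<close> by 2 on real unit vectors; its real and
  imaginary parts then contribute at most 4 each.\<close>

lemma sum_squares_le_of_grid_directions:
  fixes G :: "complex^'n"
  assumes N: "N > 0" and C: "C \<ge> 0" and B: "(\<Sum>i\<in>UNIV. cmod (G $ i)) \<le> B"
    and fine: "sqrt (real CARD('n)) / real N * (B + 1) \<le> 1 / (16 * (C + 1))"
    and step: "\<And>v :: int^'n. cmod (\<Sum>i\<in>UNIV. G $ i * of_real (of_int (v $ i) / real N))
        \<le> norm (hvec v) / real N + C * (norm (hvec v) / real N)\<^sup>2"
  shows "(\<Sum>i\<in>UNIV. (cmod (G $ i))\<^sup>2) \<le> 8"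
proof -
  define s where "s = 1 / (4 * (C + 1))"
  define \<delta> where "\<delta> = sqrt (real CARD('n)) / real N"
  have B0: "0 \<le> B" using B by (smt (verit) norm_ge_zero sum_nonneg)
  have s: "s > 0" "C * s \<le> 1 / 4" using C by (auto simp: s_def field_simps)
  have \<delta>0: "0 \<le> \<delta>" by (simp add: \<delta>_def)
  have fine': "\<delta> * B + \<delta> \<le> s / 4" using fine by (simp add: s_def \<delta>_def distrib_left)
  have \<delta>: "\<delta> \<le> s / 4" "B * \<delta> + \<delta> \<le> s / 4"
    using fine' mult_nonneg_nonneg[OF \<delta>0 B0] by (simp_all add: mult.commute)
  have dir: "cmod (\<Sum>i\<in>UNIV. G $ i * of_real (u $ i)) \<le> 2" if u: "norm u = 1" for u :: "real^'n"
  proof -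
    define v :: "int^'n" where "v = (\<chi> i. \<lfloor>real N * s * u $ i\<rfloor>)"
    define w where "w = hvec v /\<^sub>R real N"
    define r where "r = w - s *\<^sub>R u"
    have r_i: "\<bar>r $ i\<bar> \<le> 1 / real N" for i
    proof -
      have "\<bar>of_int \<lfloor>real N * s * u $ i\<rfloor> - real N * s * u $ i\<bar> \<le> 1" by linarith
      moreover have "r $ i = (of_int \<lfloor>real N * s * u $ i\<rfloor> - real N * s * u $ i) / real N"
        using N by (simp add: r_def w_def v_def field_simps)
      ultimately show ?thesis using N by (simp add: divide_right_mono)
    qed
    have norm_r: "norm r \<le> \<delta>" using norm_vec_le_sqrt_card[of r, OF r_i] by (simp add: \<delta>_def)
    have w_eq: "w = s *\<^sub>R u + r" by (simp add: r_def)
    have norm_w: "norm w \<le> 5 / 4 * s"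
      using norm_triangle_ineq[of "s *\<^sub>R u" r] norm_r u s \<delta>(1) by (simp add: w_eq)
    have norm_w': "norm w = norm (hvec v) / real N" using N by (simp add: w_def field_simps)
    have "cmod (\<Sum>i\<in>UNIV. G $ i * of_real (w $ i)) \<le> norm w + C * (norm w)\<^sup>2"
      using step[of v] unfolding norm_w' by (simp add: w_def divide_inverse mult.commute)
    also have "\<dots> \<le> 5 / 4 * s + C * (5 / 4 * s)\<^sup>2"
      using norm_w C by (intro add_mono mult_left_mono power_mono) auto
    also have "C * (5 / 4 * s)\<^sup>2 = 25 / 16 * (C * s) * s" by (simp add: power2_eq_square)
    also have "\<dots> \<le> 25 / 16 * (1 / 4) * s" using s by (intro mult_right_mono mult_left_mono) auto
    finally have 1: "cmod (\<Sum>i\<in>UNIV. G $ i * of_real (w $ i)) \<le> 5 / 4 * s + 25 / 64 * s" by simp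
    have "cmod (\<Sum>i\<in>UNIV. G $ i * of_real (r $ i)) \<le> (\<Sum>i\<in>UNIV. cmod (G $ i) * \<delta>)"
      using component_le_norm_cart[of r] norm_r
      by (intro sum_norm_le) (auto simp: norm_mult intro!: mult_left_mono intro: order_trans)
    also have "\<dots> \<le> B * \<delta>" unfolding sum_distrib_right[symmetric] using B \<delta>0 by (rule mult_right_mono)
    finally have 2: "cmod (\<Sum>i\<in>UNIV. G $ i * of_real (r $ i)) \<le> B * \<delta>" .
    have "of_real s * (\<Sum>i\<in>UNIV. G $ i * of_real (u $ i)) =
        (\<Sum>i\<in>UNIV. G $ i * of_real (w $ i)) - (\<Sum>i\<in>UNIV. G $ i * of_real (r $ i))"
      by (simp add: w_eq sum_distrib_left sum.distrib algebra_simps)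
    then have "cmod (of_real s * (\<Sum>i\<in>UNIV. G $ i * of_real (u $ i))) \<le> 5 / 4 * s + 25 / 64 * s + B * \<delta>"
      using norm_triangle_ineq4[of "\<Sum>i\<in>UNIV. G $ i * of_real (w $ i)" "\<Sum>i\<in>UNIV. G $ i * of_real (r $ i)"] 1 2
      by simp
    \<comment> \<open>The budget is \<open>5/4 + 25/64 + 1/4 < 2\<close>: length of the rounded
      step, quadratic error, rounding error.\<close>
    also have "\<dots> \<le> s * 2" using \<delta>(2) \<delta>0 s by simp
    finally show ?thesis using s by (simp add: norm_mult)
  qed
  have part: "(norm g)\<^sup>2 \<le> 4"
    if g: "\<And>u. g \<bullet> u \<le> cmod (\<Sum>i\<in>UNIV. G $ i * of_real (u $ i))" for g :: "real^'n"
  proof (cases "g = 0")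
    case False
    have "norm g = g \<bullet> (g /\<^sub>R norm g)"
      using False by (simp add: dot_square_norm power2_eq_square)
    also have "\<dots> \<le> cmod (\<Sum>i\<in>UNIV. G $ i * of_real ((g /\<^sub>R norm g) $ i))" by (rule g)
    also have "\<dots> \<le> 2" by (rule dir) (use False in simp)
    finally have "(norm g)\<^sup>2 \<le> 2\<^sup>2" by (intro power_mono) auto
    then show ?thesis by simp
  qed simp
  have "(norm (\<chi> i. Re (G $ i)))\<^sup>2 \<le> 4"
  proof (rule part)
    fix u :: "real^'n"
    have "(\<chi> i. Re (G $ i)) \<bullet> u = Re (\<Sum>i\<in>UNIV. G $ i * of_real (u $ i))"
      by (simp add: inner_vec_def)
    also have "\<dots> \<le> cmod (\<Sum>i\<in>UNIV. G $ i * of_real (u $ i))" by (rule complex_Re_le_cmod)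
    finally show "(\<chi> i. Re (G $ i)) \<bullet> u \<le> cmod (\<Sum>i\<in>UNIV. G $ i * of_real (u $ i))" .
  qed
  moreover have "(norm (\<chi> i. Im (G $ i)))\<^sup>2 \<le> 4"
  proof (rule part)
    fix u :: "real^'n"
    have "(\<chi> i. Im (G $ i)) \<bullet> u = Im (\<Sum>i\<in>UNIV. G $ i * of_real (u $ i))"
      by (simp add: inner_vec_def)
    also have "\<dots> \<le> cmod (\<Sum>i\<in>UNIV. G $ i * of_real (u $ i))"
      using abs_Im_le_cmod[of "\<Sum>i\<in>UNIV. G $ i * of_real (u $ i)"] by linarith
    finally show "(\<chi> i. Im (G $ i)) \<bullet> u \<le> cmod (\<Sum>i\<in>UNIV. G $ i * of_real (u $ i))" .
  qed
  ultimately show ?thesis by (simp add: norm_power2_vec cmod_power2 sum.distrib)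
qed

text \<open>The kernel is understood only through its averages of cosines of degree one, so the
  squared distance to the integers has to be dominated by such a function. The factor
  \<open>1/8\<close> would be sharp; \<open>1/4\<close> leaves room for crude estimates of the sine
  and of \<open>pi\<close>.\<close>

lemma dist_nearest_int_le:
  fixes t :: real
  shows "(t - of_int (round t))\<^sup>2 \<le> (1 - cos (2 * pi * t)) / 4"
proof -
  define r where "r = t - of_int (round t)"
  have r: "\<bar>r\<bar> \<le> 1 / 2" using of_int_round_abs_le[of t] by (simp add: r_def abs_minus_commute)
  define x where "x = pi * r"
  have "\<bar>x\<bar> \<le> 1.6" 
  proof -
    have "\<bar>x\<bar> = pi * \<bar>r\<bar>" by (simp add: x_def abs_mult)
    also have "\<dots> \<le> 3.2 * (1 / 2)" using r pi_approx by (intro mult_mono) auto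
    finally show ?thesis by simp
  qed
  then have x2: "\<bar>x\<bar>\<^sup>2 \<le> 3" using power_mono[of "\<bar>x\<bar>" "1.6" 2] by (simp add: power2_eq_square)
  \<comment> \<open>From \<open>|sin x - x| <= |x|^3 / 6\<close> and \<open>x^2 <= 3\<close> follows
    \<open>|sin x| >= |x| / 2\<close>; the range of \<open>x\<close> is
    \<open>[-pi/2, pi/2]\<close>, where \<open>x^2\<close> stays below 3.\<close>
  have "\<bar>sin x - (\<Sum>k<3. sin_coeff k * x ^ k)\<bar> \<le> inverse (fact 3) * \<bar>x\<bar> ^ 3"
    by (rule Maclaurin_sin_bound)
  moreover have "(\<Sum>k<3. sin_coeff k * x ^ k) = x"
    by (simp add: sin_coeff_def numeral_3_eq_3)
  moreover have "inverse (fact 3) * \<bar>x\<bar> ^ 3 \<le> \<bar>x\<bar> / 2"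
    using mult_left_mono[OF x2, of "\<bar>x\<bar> / 6"] by (simp add: fact_numeral power3_eq_cube power2_eq_square)
  ultimately have "\<bar>x\<bar> / 2 \<le> \<bar>sin x\<bar>" by linarith
  then have "(\<bar>x\<bar> / 2)\<^sup>2 \<le> \<bar>sin x\<bar>\<^sup>2" by (intro power_mono) auto
  then have "pi\<^sup>2 * r\<^sup>2 \<le> 4 * (sin x)\<^sup>2" by (simp add: x_def power_mult_distrib power_divide)
  moreover have "9 * r\<^sup>2 \<le> pi\<^sup>2 * r\<^sup>2"
    using pi_approx power_mono[of 3 pi 2] by (intro mult_right_mono) auto
  ultimately have "9 * r\<^sup>2 \<le> 4 * (sin x)\<^sup>2" by linarith
  then have "r\<^sup>2 \<le> (sin x)\<^sup>2 / 2" using zero_le_power2[of "sin x"] by linarith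
  also have "\<dots> = (1 - cos (2 * x)) / 4" by (simp add: cos_double_sin)
  also have "cos (2 * x) = cos (2 * pi * t)"
  proof -
    have "2 * pi * t = 2 * x + 2 * pi * of_int (round t)" by (simp add: x_def r_def algebra_simps)
    also have "cos \<dots> = cos (2 * x)" by (simp add: cos_add cos_int_2pin sin_int_2pin)
    finally show ?thesis ..
  qed
  finally show ?thesis by (simp add: r_def)
qed

lemma one_minus_cos_le: "1 - cos x \<le> x\<^sup>2 / 2" for x :: real
proof -
  have "1 - cos x = 2 * (sin (x / 2))\<^sup>2" using cos_double_sin[of "x / 2"] by simp
  also have "(sin (x / 2))\<^sup>2 \<le> (x / 2)\<^sup>2"
    by (rule abs_le_square_iff[THEN iffD1, OF abs_sin_x_le_abs_x])
  finally show ?thesis by (simp add: power_divide)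
qed

lemma cis_second_order: "cmod (cis t - 1 - \<i> * of_real t) \<le> t\<^sup>2 / 2"
  using iexp_approx1[of t 1] by (simp add: cis_conv_exp algebra_simps power2_eq_square numeral_2_eq_2)

lemma norm_hvec_grid_le:
  fixes y :: "int^'n"
  assumes "y \<in> grid N" "N > 0"
  shows "norm (hvec y) / real N \<le> sqrt (real CARD('n))"
proof -
  have "\<bar>hvec y $ i\<bar> \<le> real N" for i
  proof -
    have "0 \<le> y $ i" "y $ i \<le> int N" using assms(1) by (auto simp: grid_def less_imp_le)
    then have "0 \<le> real_of_int (y $ i)" "real_of_int (y $ i) \<le> real N" by linarith+
    then show ?thesis by simp
  qed
  then have "norm (hvec y) \<le> sqrt (real CARD('n)) * real N" by (rule norm_vec_le_sqrt_card)
  then show ?thesis using assms(2) by (simp add: divide_le_eq)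
qed

text \<open>By periodicity the displacement \<open>y\<close> may be replaced by its shortest
  representative, obtained by subtracting N times the nearest integer in each coordinate. Its length
  is then governed by distances to the nearest integer.\<close>

lemma periodic_lipschitz_dist:
  fixes f :: "int^'n \<Rightarrow> real"
  assumes N: "N > 0" and per: "\<And>x. f (gmod N x) = f x"
    and lip: "\<And>x y. \<bar>f x - f y\<bar> \<le> norm (hvec (x - y)) / real N"
  shows "\<bar>f x - f (x - y)\<bar>\<^sup>2 \<le> (\<Sum>i\<in>UNIV. (1 - cos (2 * pi * (of_int (y $ i) / real N))) / 4)"
proof -
  define z :: "int^'n" where "z = (\<chi> i. int N * round (of_int (y $ i) / real N))"
  have "gmod N (x - y) = gmod N (x - (y - z))"
    by (simp add: gmod_def z_def vec_eq_iff mod_eq_dvd_iff algebra_simps)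
  then have "f (x - y) = f (x - (y - z))" using per by metis
  then have "\<bar>f x - f (x - y)\<bar> \<le> norm (hvec (y - z)) / real N" using lip[of x "x - (y - z)"] by simp
  then have "\<bar>f x - f (x - y)\<bar>\<^sup>2 \<le> (norm (hvec (y - z)) / real N)\<^sup>2" by (intro power_mono) auto
  also have "\<dots> = (\<Sum>i\<in>UNIV. (of_int ((y - z) $ i) / real N)\<^sup>2)"
    by (simp only: power_divide norm_power2_vec hvec_nth sum_divide_distrib)
  also have "\<dots> = (\<Sum>i\<in>UNIV. (of_int (y $ i) / real N - of_int (round (of_int (y $ i) / real N)))\<^sup>2)"
    using N by (simp add: z_def diff_divide_distrib)
  also have "\<dots> \<le> (\<Sum>i\<in>UNIV. (1 - cos (2 * pi * (of_int (y $ i) / real N))) / 4)"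
    by (intro sum_mono dist_nearest_int_le)
  finally show ?thesis .
qed

lemma echar_axis: "echar N (axis i 1) y = cis (2 * pi * (of_int (y $ i) / real N))"
  "echar N (- axis i 1) y = cis (- (2 * pi * (of_int (y $ i) / real N)))"
proof -
  have "hvec (axis i 1) \<bullet> hvec y = of_int (y $ i)"
    by (simp add: inner_hvec axis_def if_distrib if_distribR cong: if_cong)
  then show "echar N (axis i 1) y = cis (2 * pi * (of_int (y $ i) / real N))"
    "echar N (- axis i 1) y = cis (- (2 * pi * (of_int (y $ i) / real N)))"
    by (simp_all add: echar_def hvec_minus)
qed

section \<open>Smoothing Lipschitz functions on the grid\<close>

lemma jackson_kernel:
  fixes \<kappa> :: "int^'n \<Rightarrow> real"
  assumes N: "N > m + 1"
    and out: "\<And>h. h \<notin> freqs m \<Longrightarrow> \<kappa> h = 0" and one: "\<kappa> 0 = 1"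
    and axis: "\<And>i. \<kappa> (axis i 1) + \<kappa> (- axis i 1) = 2 * c"
    and pos: "\<And>y. \<exists>r\<ge>0. (\<Sum>h\<in>freqs m. of_real (\<kappa> h) * echar N h y) = complex_of_real r"
  obtains k where "\<And>y. 0 \<le> k y" "\<And>y. (\<Sum>h\<in>freqs m. of_real (\<kappa> h) * echar N h y) = complex_of_real (k y)"
    "gavg N k = 1" "\<And>i. gavg N (\<lambda>y. cos (2 * pi * (of_int (y $ i) / real N)) * k y) = c"
proof -
  obtain k where k: "\<And>y. 0 \<le> k y" "\<And>y. (\<Sum>h\<in>freqs m. of_real (\<kappa> h) * echar N h y) = complex_of_real (k y)"
    using pos by metis
  have avg: "gavg N (\<lambda>y. echar N l y * of_real (k y)) = of_real (\<kappa> (- l))" if "\<And>i. \<bar>l $ i\<bar> \<le> 1" for l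
    using gavg_jackson_kernel[where \<kappa> = \<kappa>, OF N out that] by (simp add: k(2))
  have "complex_of_real (gavg N k) = 1"
    using avg[of 0] one by (simp add: gavg_of_real)
  then have "gavg N k = 1" by (simp only: of_real_eq_1_iff)
  moreover have "gavg N (\<lambda>y. cos (2 * pi * (of_int (y $ i) / real N)) * k y) = c" for i
  proof -
    \<comment> \<open>Twice the cosine is a sum of two opposite characters, so only the sum of the
      coefficients at \<open>axis i 1\<close> and \<open>- axis i 1\<close> enters.\<close>
    have cos: "complex_of_real (2 * (cos t * r)) = cis t * of_real r + cis (- t) * of_real r" for t r
      by (simp add: complex_eq_iff)
    have "complex_of_real (2 * gavg N (\<lambda>y. cos (2 * pi * (of_int (y $ i) / real N)) * k y)) =
        gavg N (\<lambda>y. complex_of_real (2 * (cos (2 * pi * (of_int (y $ i) / real N)) * k y)))"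
      by (simp only: gavg_of_real gavg_cmult)
    also have "\<dots> = gavg N (\<lambda>y. echar N (axis i 1) y * of_real (k y)) + gavg N (\<lambda>y. echar N (- axis i 1) y * of_real (k y))"
      unfolding cos echar_axis gavg_add ..
    also have "\<dots> = of_real (\<kappa> (- axis i 1) + \<kappa> (axis i 1))"
      by (subst (1 2) avg) (auto simp: axis_def)
    also have "\<dots> = of_real (2 * c)" using axis[of i] by (simp add: add.commute)
    finally show ?thesis by (simp only: of_real_eq_iff)
  qed
  ultimately show thesis using k that by blast
qed

text \<open>The polynomial is the convolution of \<open>f\<close> with the kernel, so it inherits
  the Lipschitz constant, and its coefficients are \<open>\<kappa> h\<close> times those of
  \<open>f\<close>. The order of quantifiers matters: \<open>N0\<close> must serve all
  \<open>f\<close> at once, because duality ranges over every test function. This works since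
  \<open>f 0 = 0\<close> and the Lipschitz condition bound the coefficients by \<open>b h\<close>,
  whatever \<open>f\<close> and \<open>N\<close> are.\<close>

lemma lipschitz_grid_smoothing:
  fixes m :: nat
  obtains N0 where "\<And>N (f :: int^'n \<Rightarrow> real). N \<ge> N0 \<Longrightarrow> (\<And>x. f (gmod N x) = f x) \<Longrightarrow>
      (\<And>x y. \<bar>f x - f y\<bar> \<le> norm (hvec (x - y)) / real N) \<Longrightarrow> f 0 = 0 \<Longrightarrow>
      \<exists>c. (\<forall>x. cmod (of_real (f x) - (\<Sum>h\<in>freqs m. c h * echar N h x)) \<le> sqrt (real CARD('n)) * pi / (2 * (real m + 2)))
        \<and> (\<Sum>h\<in>freqs m. (norm (hvec h))\<^sup>2 * (cmod (c h))\<^sup>2) \<le> 1"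
proof -
  define \<theta> where "\<theta> = pi / (real m + 2)"
  obtain \<kappa> :: "int^'n \<Rightarrow> real" where \<kappa>: "\<And>h. 0 \<le> \<kappa> h" "\<And>h. h \<notin> freqs m \<Longrightarrow> \<kappa> h = 0" "\<kappa> 0 = 1"
    "\<And>i. \<kappa> (axis i 1) + \<kappa> (- axis i 1) = 2 * cos \<theta>"
    "\<And>N y. \<exists>r\<ge>0. (\<Sum>h\<in>freqs m. of_real (\<kappa> h) * echar N h y) = complex_of_real r"
    unfolding \<theta>_def using jackson_kernel_coefficients by blast
  define b where "b h = \<kappa> h * sqrt (real CARD('n))" for h
  define B where "B = (\<Sum>i\<in>(UNIV :: 'n set). \<Sum>h\<in>freqs m. 2 * pi * norm (hvec h) * b h)"
  define C where "C = (\<Sum>h\<in>freqs m. (2 * pi * norm (hvec h))\<^sup>2 / 2 * b h)"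
  have b0: "0 \<le> b h" for h using \<kappa>(1) by (simp add: b_def)
  have C0: "0 \<le> C" unfolding C_def using b0 by (intro sum_nonneg) simp
  \<comment> \<open>The summand \<open>2 * m + 2\<close> keeps the frequencies in
    \<open>freqs m\<close> incongruent modulo N and the kernel averages exact; the ceiling provides
    the fineness that the gradient bound demands.\<close>
  define N0 where "N0 = 2 * m + 2 + nat \<lceil>sqrt (real CARD('n)) * (B + 1) * (16 * (C + 1))\<rceil>"
  show thesis
  proof (rule that[of N0])
    fix N and f :: "int^'n \<Rightarrow> real"
    assume N0: "N \<ge> N0" and per: "\<And>x. f (gmod N x) = f x"
      and lip: "\<And>x y. \<bar>f x - f y\<bar> \<le> norm (hvec (x - y)) / real N" and f0: "f 0 = 0"
    have N: "N > 0" "N > m + 1" "N > 2 * m" using N0 by (auto simp: N0_def)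
    have "sqrt (real CARD('n)) * (B + 1) * (16 * (C + 1)) \<le> real N"
      using N0 unfolding N0_def by linarith
    then have fine: "sqrt (real CARD('n)) / real N * (B + 1) \<le> 1 / (16 * (C + 1))"
      using N(1) C0 by (simp add: field_simps)
    obtain k where k: "\<And>y. 0 \<le> k y"
      "\<And>y. (\<Sum>h\<in>freqs m. of_real (\<kappa> h) * echar N h y) = complex_of_real (k y)"
      "gavg N k = 1" "\<And>i. gavg N (\<lambda>y. cos (2 * pi * (of_int (y $ i) / real N)) * k y) = cos \<theta>"
      using jackson_kernel[OF N(2) \<kappa>(2-4) \<kappa>(5)] by blast
    define c where "c h = of_real (\<kappa> h) * gavg N (\<lambda>y. of_real (f y) * echar N (- h) y)" for h
    define P where "P x = (\<Sum>h\<in>freqs m. c h * echar N h x)" for x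
    have P_conv: "P x = of_real (gavg N (\<lambda>y. f (x - y) * k y))" for x
    proof -
      have "P x = (\<Sum>h\<in>freqs m. gavg N (\<lambda>y. (of_real (\<kappa> h) * echar N h x) * (of_real (f y) * echar N (- h) y)))"
        unfolding P_def c_def gavg_cmult by (simp add: mult_ac)
      also have "\<dots> = gavg N (\<lambda>y. of_real (f y) * (\<Sum>h\<in>freqs m. of_real (\<kappa> h) * echar N h (x - y)))"
        unfolding gavg_sum[symmetric] by (simp add: echar_diff_right sum_distrib_left mult_ac)
      also have "\<dots> = gavg N (\<lambda>y. of_real (f (x - (x - y)) * k (x - y)))" by (simp add: k(2))
      also have "\<dots> = gavg N (\<lambda>y. complex_of_real (f (x - y) * k y))"
      proof (rule gavg_reflect[OF N(1)])
        fix y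
        have "f (x - gmod N y) = f (x - y)" using per gmod_diff_gmod by metis
        moreover have "complex_of_real (k (gmod N y)) = complex_of_real (k y)"
          unfolding k(2)[symmetric] using N(1) by simp
        ultimately show "complex_of_real (f (x - gmod N y) * k (gmod N y)) = complex_of_real (f (x - y) * k y)"
          by simp
      qed
      finally show ?thesis by (simp only: gavg_of_real)
    qed
    have P_lip: "cmod (P (x + v) - P x) \<le> norm (hvec v) / real N" for x v
    proof -
      have "P (x + v) - P x = of_real (gavg N (\<lambda>y. (f (x + v - y) - f (x - y)) * k y))"
        unfolding P_conv of_real_diff[symmetric] gavg_diff[symmetric] left_diff_distrib ..
      then have "cmod (P (x + v) - P x) = \<bar>gavg N (\<lambda>y. (f (x + v - y) - f (x - y)) * k y)\<bar>" by simp
      also have "\<dots> \<le> gavg N (\<lambda>y. \<bar>(f (x + v - y) - f (x - y)) * k y\<bar>)"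
        using norm_gavg_le[of N "\<lambda>y. (f (x + v - y) - f (x - y)) * k y"] by simp
      also have "\<dots> \<le> gavg N (\<lambda>y. norm (hvec v) / real N * k y)"
      proof (rule gavg_mono)
        fix y
        have "\<bar>f (x + v - y) - f (x - y)\<bar> \<le> norm (hvec v) / real N"
          using lip[of "x + v - y" "x - y"] by (simp add: algebra_simps)
        then show "\<bar>(f (x + v - y) - f (x - y)) * k y\<bar> \<le> norm (hvec v) / real N * k y"
          unfolding abs_mult abs_of_nonneg[OF k(1)] using k(1) by (rule mult_right_mono)
      qed
      also have "\<dots> = norm (hvec v) / real N" using k(3) by (simp only: gavg_cmult mult_1_right)
      finally show ?thesis .
    qed
    have P_approx: "cmod (of_real (f x) - P x) \<le> sqrt (real CARD('n)) * pi / (2 * (real m + 2))" for x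
    proof -
      \<comment> \<open>The AM-GM parameter is the very bound to be proved. As
        \<open>1 - cos \<theta>\<close> is at most \<open>\<theta>^2 / 2\<close>, the kernel average
        of the cosine majorant is at most \<open>CARD('n) * \<theta>^2 / 8 = t^2 / 2\<close>, and
        the two AM-GM terms come to \<open>t / 4\<close> and \<open>t / 2\<close>.\<close>
      define t where "t = sqrt (real CARD('n)) * \<theta> / 2"
      have \<theta>: "\<theta> > 0" by (simp add: \<theta>_def)
      have t: "t > 0" using \<theta> by (simp add: t_def)
      have "f x - gavg N (\<lambda>y. f (x - y) * k y) = gavg N (\<lambda>y. f x * k y) - gavg N (\<lambda>y. f (x - y) * k y)"
        by (simp add: gavg_cmult k(3))
      also have "\<dots> = gavg N (\<lambda>y. (f x - f (x - y)) * k y)"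
        by (simp add: gavg_diff[symmetric] left_diff_distrib)
      finally have "of_real (f x) - P x = complex_of_real (gavg N (\<lambda>y. (f x - f (x - y)) * k y))"
        unfolding P_conv of_real_diff[symmetric] by (simp only:)
      then have "cmod (of_real (f x) - P x) = \<bar>gavg N (\<lambda>y. (f x - f (x - y)) * k y)\<bar>"
        by (simp only: norm_of_real)
      also have "\<dots> \<le> gavg N (\<lambda>y. \<bar>(f x - f (x - y)) * k y\<bar>)"
        using norm_gavg_le[of N "\<lambda>y. (f x - f (x - y)) * k y"] by simp
      also have "\<dots> \<le> gavg N (\<lambda>y. (\<Sum>i\<in>UNIV. 1 / (8 * t) * (k y - cos (2 * pi * (of_int (y $ i) / real N)) * k y)) + t / 2 * k y)"
      proof (rule gavg_mono)
        fix y
        let ?D = "\<bar>f x - f (x - y)\<bar>" and ?S = "\<Sum>i\<in>UNIV. (1 - cos (2 * pi * (of_int (y $ i) / real N))) / 4"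
        \<comment> \<open>AM-GM replaces \<open>?D\<close> by \<open>?D\<^sup>2\<close>, whose average against \<open>k\<close> only involves \<open>cos \<theta>\<close>.\<close>
        have "2 * ?D * t \<le> ?D\<^sup>2 + t\<^sup>2"
          using sum_squares_bound[of ?D t] by simp
        also have "\<dots> \<le> ?S + t\<^sup>2" using periodic_lipschitz_dist[OF N(1) per lip, of x y] by simp
        finally have "?D \<le> ?S / (2 * t) + t / 2" using t by (simp add: field_simps power2_eq_square)
        then have "?D * k y \<le> (?S / (2 * t) + t / 2) * k y" using k(1) by (rule mult_right_mono)
        also have "\<dots> = (\<Sum>i\<in>UNIV. 1 / (8 * t) * (k y - cos (2 * pi * (of_int (y $ i) / real N)) * k y)) + t / 2 * k y"
          by (simp add: distrib_right sum_divide_distrib sum_distrib_right left_diff_distrib diff_divide_distrib)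
        finally show "\<bar>(f x - f (x - y)) * k y\<bar> \<le>
            (\<Sum>i\<in>UNIV. 1 / (8 * t) * (k y - cos (2 * pi * (of_int (y $ i) / real N)) * k y)) + t / 2 * k y"
          using k(1)[of y] by (simp add: abs_mult)
      qed
      also have "\<dots> = real CARD('n) * (1 / (8 * t) * (1 - cos \<theta>)) + t / 2"
        by (simp only: gavg_add gavg_sum gavg_cmult gavg_diff k(3,4) sum_constant mult_1_right)
      also have "\<dots> \<le> real CARD('n) * (1 / (8 * t) * (\<theta>\<^sup>2 / 2)) + t / 2"
        using t by (intro add_mono mult_left_mono one_minus_cos_le) auto
      also have "real CARD('n) * (1 / (8 * t) * (\<theta>\<^sup>2 / 2)) = t\<^sup>2 / (4 * t)"
        by (simp add: t_def power_mult_distrib power_divide)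
      also have "t\<^sup>2 / (4 * t) + t / 2 \<le> t" using t by (simp add: power2_eq_square)
      finally show ?thesis by (simp add: t_def \<theta>_def mult.commute)
    qed
    have c_le: "cmod (c h) \<le> b h" for h
    proof -
      have "cmod (gavg N (\<lambda>y. of_real (f y) * echar N (- h) y)) \<le> gavg N (\<lambda>y. cmod (of_real (f y) * echar N (- h) y))"
        by (rule norm_gavg_le)
      also have "\<dots> \<le> gavg N (\<lambda>y :: int^'n. sqrt (real CARD('n)))"
      proof (rule gavg_mono)
        fix y :: "int^'n" assume "y \<in> grid N"
        then show "cmod (of_real (f y) * echar N (- h) y) \<le> sqrt (real CARD('n))"
          using norm_hvec_grid_le[of y N] N(1) lip[of y 0] f0 by (simp add: norm_mult)
      qed
      also have "\<dots> = sqrt (real CARD('n))" using N(1) by (rule gavg_const)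
      finally show ?thesis
        unfolding c_def b_def norm_mult norm_of_real using \<kappa>(1)[of h] by (simp add: mult_left_mono)
    qed
    \<comment> \<open>The gradient of the polynomial \<open>P\<close> with respect to the torus
      variable \<open>x / N\<close>, whence the factor \<open>2 * pi\<close> without any N.\<close>
    define G where "G x = (\<chi> i. \<Sum>h\<in>freqs m. (2 * pi * \<i> * of_int (h $ i) * c h) * echar N h x)" for x
    have G_le: "(\<Sum>i\<in>UNIV. cmod (G x $ i)) \<le> B" for x
      unfolding B_def
    proof (rule sum_mono)
      fix i
      have "cmod (G x $ i) \<le> (\<Sum>h\<in>freqs m. cmod ((2 * pi * \<i> * of_int (h $ i) * c h) * echar N h x))"
        unfolding G_def vec_lambda_beta by (rule norm_sum)
      also have "\<dots> \<le> (\<Sum>h\<in>freqs m. 2 * pi * norm (hvec h) * b h)"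
      proof (rule sum_mono)
        fix h :: "int^'n"
        have "\<bar>of_int (h $ i)\<bar> \<le> norm (hvec h)" using component_le_norm_cart[of "hvec h" i] by simp
        then show "cmod ((2 * pi * \<i> * of_int (h $ i) * c h) * echar N h x) \<le> 2 * pi * norm (hvec h) * b h"
          unfolding norm_mult using c_le[of h] b0[of h]
          by (simp add: mult_mono)
      qed
      finally show "cmod (G x $ i) \<le> (\<Sum>h\<in>freqs m. 2 * pi * norm (hvec h) * b h)" .
    qed
    have G_step: "cmod (\<Sum>i\<in>UNIV. G x $ i * of_real (of_int (v $ i) / real N))
        \<le> norm (hvec v) / real N + C * (norm (hvec v) / real N)\<^sup>2" for x v
    proof -
      \<comment> \<open>The phase gained by the character \<open>h\<close> along \<open>v\<close>.
        Expanding \<open>cis (\<tau> h)\<close> to first order, the linear parts add up to the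
        pairing of \<open>G\<close> with \<open>v / N\<close>, and the remainders, at most
        \<open>(\<tau> h)^2 / 2\<close> each, add up to the constant \<open>C\<close>.\<close>
      define \<tau> where "\<tau> h = 2 * pi * (hvec h \<bullet> hvec v) / real N" for h :: "int^'n"
      have \<tau>: "\<i> * of_real (\<tau> h) = (\<Sum>i\<in>UNIV. 2 * pi * \<i> * of_int (h $ i) * of_real (of_int (v $ i) / real N))" for h
        by (simp add: \<tau>_def inner_hvec sum_distrib_left sum_divide_distrib mult_ac)
      have ev: "echar N h v = cis (\<tau> h)" for h by (simp add: echar_def \<tau>_def)
      have "(\<Sum>i\<in>UNIV. G x $ i * of_real (of_int (v $ i) / real N)) = (\<Sum>h\<in>freqs m. c h * echar N h x * (\<i> * of_real (\<tau> h)))"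
        unfolding \<tau> G_def vec_lambda_beta sum_distrib_left sum_distrib_right
        by (subst sum.swap) (simp add: mult_ac)
      also have "\<dots> = (P (x + v) - P x) - (\<Sum>h\<in>freqs m. c h * echar N h x * (cis (\<tau> h) - 1 - \<i> * of_real (\<tau> h)))"
        by (simp add: P_def echar_add_right ev sum_subtractf[symmetric] algebra_simps
            sum.distrib[symmetric])
      also have "cmod \<dots> \<le> cmod (P (x + v) - P x) + cmod (\<Sum>h\<in>freqs m. c h * echar N h x * (cis (\<tau> h) - 1 - \<i> * of_real (\<tau> h)))"
        by (rule norm_triangle_ineq4)
      also have "cmod (\<Sum>h\<in>freqs m. c h * echar N h x * (cis (\<tau> h) - 1 - \<i> * of_real (\<tau> h)))
          \<le> (\<Sum>h\<in>freqs m. (2 * pi * norm (hvec h))\<^sup>2 / 2 * b h * (norm (hvec v) / real N)\<^sup>2)"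
      proof (rule sum_norm_le)
        fix h :: "int^'n"
        have "\<bar>\<tau> h\<bar> = 2 * pi * \<bar>hvec h \<bullet> hvec v\<bar> / real N" by (simp add: \<tau>_def abs_mult)
        also have "\<dots> \<le> 2 * pi * (norm (hvec h) * norm (hvec v)) / real N"
          by (intro divide_right_mono mult_left_mono Cauchy_Schwarz_ineq2) auto
        finally have "(\<tau> h)\<^sup>2 \<le> (2 * pi * norm (hvec h) * (norm (hvec v) / real N))\<^sup>2"
          using power_mono[of "\<bar>\<tau> h\<bar>" _ 2] by (simp add: mult_ac)
        then have "(\<tau> h)\<^sup>2 \<le> (2 * pi * norm (hvec h))\<^sup>2 * (norm (hvec v) / real N)\<^sup>2"
          by (simp only: power_mult_distrib)
        from divide_right_mono[OF this, of 2] have "(\<tau> h)\<^sup>2 / 2 \<le> (2 * pi * norm (hvec h))\<^sup>2 / 2 * (norm (hvec v) / real N)\<^sup>2"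
          by simp
        then have "cmod (c h) * cmod (cis (\<tau> h) - 1 - \<i> * of_real (\<tau> h))
            \<le> b h * ((2 * pi * norm (hvec h))\<^sup>2 / 2 * (norm (hvec v) / real N)\<^sup>2)"
          using c_le[of h] b0[of h] cis_second_order[of "\<tau> h"] by (intro mult_mono) auto
        then show "cmod (c h * echar N h x * (cis (\<tau> h) - 1 - \<i> * of_real (\<tau> h)))
            \<le> (2 * pi * norm (hvec h))\<^sup>2 / 2 * b h * (norm (hvec v) / real N)\<^sup>2"
          by (simp add: norm_mult mult_ac)
      qed
      also have "\<dots> = C * (norm (hvec v) / real N)\<^sup>2" by (simp only: C_def sum_distrib_right)
      finally show ?thesis using P_lip[of x v] by linarith
    qed
    have "4 * pi\<^sup>2 * (\<Sum>h\<in>freqs m. (norm (hvec h))\<^sup>2 * (cmod (c h))\<^sup>2) =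
        (\<Sum>i\<in>UNIV. \<Sum>h\<in>freqs m. (cmod (2 * pi * \<i> * of_int (h $ i) * c h))\<^sup>2)"
      by (subst sum.swap) (simp add: norm_mult norm_power2_vec power_mult_distrib sum_distrib_left sum_distrib_right mult_ac)
    also have "\<dots> = (\<Sum>i\<in>UNIV. gavg N (\<lambda>x. (cmod (G x $ i))\<^sup>2))"
      unfolding G_def vec_lambda_beta
    proof (intro sum.cong refl gavg_parseval[symmetric])
      fix h l :: "int^'n" assume hl: "h \<in> freqs m" "l \<in> freqs m" "\<forall>i. int N dvd (h - l) $ i"
      have "h $ i = l $ i" for i
      proof (rule ccontr)
        assume "h $ i \<noteq> l $ i"
        then have "(h - l) $ i \<noteq> 0" by simp
        from dvd_imp_le_int[OF this, of "int N"] hl(3) have "int N \<le> \<bar>h $ i - l $ i\<bar>" by simp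
        moreover have "\<bar>h $ i\<bar> \<le> int m" "\<bar>l $ i\<bar> \<le> int m" using hl by (auto simp: freqs_def)
        ultimately show False using N(3) by linarith
      qed
      then show "h = l" by (simp add: vec_eq_iff)
    qed (use N in auto)
    also have "\<dots> = gavg N (\<lambda>x. \<Sum>i\<in>UNIV. (cmod (G x $ i))\<^sup>2)" by (rule gavg_sum[symmetric])
    also have "\<dots> \<le> gavg N (\<lambda>x :: int^'n. 8)"
      by (intro gavg_mono sum_squares_le_of_grid_directions[OF N(1) C0 G_le fine G_step])
    also have "\<dots> = 8" using N(1) by (rule gavg_const)
    finally have "4 * pi\<^sup>2 * (\<Sum>h\<in>freqs m. (norm (hvec h))\<^sup>2 * (cmod (c h))\<^sup>2) \<le> 8" .
    \<comment> \<open>Already \<open>pi >= 3\<close> gives \<open>8 / 36 < 1\<close>, so the factors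
      lost in the gradient bound cost nothing here.\<close>
    moreover have "4 * 9 * (\<Sum>h\<in>freqs m. (norm (hvec h))\<^sup>2 * (cmod (c h))\<^sup>2) \<le>
        4 * pi\<^sup>2 * (\<Sum>h\<in>freqs m. (norm (hvec h))\<^sup>2 * (cmod (c h))\<^sup>2)"
      using power_mono[of 3 pi 2] pi_approx by (intro mult_right_mono sum_nonneg) auto
    ultimately have "(\<Sum>h\<in>freqs m. (norm (hvec h))\<^sup>2 * (cmod (c h))\<^sup>2) \<le> 1" by linarith
    with P_approx show "\<exists>c. (\<forall>x. cmod (of_real (f x) - (\<Sum>h\<in>freqs m. c h * echar N h x)) \<le> sqrt (real CARD('n)) * pi / (2 * (real m + 2)))
        \<and> (\<Sum>h\<in>freqs m. (norm (hvec h))\<^sup>2 * (cmod (c h))\<^sup>2) \<le> 1"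
      unfolding P_def by blast
  qed
qed

section \<open>Discretisation of measures on the torus\<close>

lemma torus_dist_le_norm:
  assumes "\<And>i. z $ i \<in> \<int>"
  shows "torus_dist x y \<le> norm (x - y - z)"
  unfolding torus_dist_def using assms by (intro cInf_lower bdd_belowI[of _ 0]) auto

lemma torus_dist_greatest:
  assumes "\<And>z. (\<And>i. z $ i \<in> \<int>) \<Longrightarrow> c \<le> norm (x - y - z)"
  shows "c \<le> torus_dist x y"
proof -
  have "\<exists>z :: real^'a. \<forall>i. z $ i \<in> \<int>" by (rule exI[of _ 0]) simp
  then show ?thesis unfolding torus_dist_def using assms by (intro cInf_greatest) auto
qed

lemma torus_dist_nonneg: "0 \<le> torus_dist x y"
  by (rule torus_dist_greatest) simp

lemma torus_dist_le: "torus_dist x y \<le> norm (x - y)"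
  using torus_dist_le_norm[of 0 x y] by simp

lemma torus_dist_self [simp]: "torus_dist x x = 0"
  using torus_dist_le[of x x] torus_dist_nonneg[of x x] by simp

text \<open>The sum of integer translates admissible for the two distances on the right is
  admissible on the left. The two infima are exhausted one after the other, which avoids choosing
  minimising translates.\<close>

lemma torus_dist_triangle: "torus_dist x w \<le> torus_dist x y + torus_dist y w"
proof -
  have "torus_dist x w - torus_dist y w \<le> torus_dist x y"
  proof (rule torus_dist_greatest)
    fix z :: "real^'a" assume z: "\<And>i. z $ i \<in> \<int>"
    have "torus_dist x w - norm (x - y - z) \<le> torus_dist y w"
    proof (rule torus_dist_greatest)
      fix z' :: "real^'a" assume z': "\<And>i. z' $ i \<in> \<int>"
      have "torus_dist x w \<le> norm (x - w - (z + z'))" by (rule torus_dist_le_norm) (use z z' in auto)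
      also have "x - w - (z + z') = (x - y - z) + (y - w - z')" by simp
      also have "norm \<dots> \<le> norm (x - y - z) + norm (y - w - z')" by (rule norm_triangle_ineq)
      finally show "torus_dist x w - norm (x - y - z) \<le> norm (y - w - z')" by simp
    qed
    then show "torus_dist x w - torus_dist y w \<le> norm (x - y - z)" by simp
  qed
  then show ?thesis by simp
qed

section \<open>Rounding points and measures to the grid\<close>

definition cell :: "nat \<Rightarrow> real^'n \<Rightarrow> int^'n" where
  "cell N a = (\<chi> i. \<lfloor>real N * a $ i\<rfloor>)"

definition cell_set :: "nat \<Rightarrow> int^'n \<Rightarrow> (real^'n) set" where
  "cell_set N x = {a \<in> torus_cube. cell N a = x}"

lemma cell_in_grid:
  assumes "a \<in> torus_cube" "N > 0" shows "cell N a \<in> grid N"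
proof -
  have "0 \<le> \<lfloor>real N * a $ i\<rfloor> \<and> \<lfloor>real N * a $ i\<rfloor> < int N" for i
  proof -
    have "0 \<le> a $ i" "a $ i < 1" using assms by (auto simp: torus_cube_def)
    then have "0 \<le> real N * a $ i" "real N * a $ i < real N * 1"
      using assms(2) by (auto intro: mult_strict_left_mono)
    then show ?thesis by (simp add: floor_less_iff)
  qed
  then show ?thesis by (simp add: cell_def grid_def)
qed

lemma norm_cell_diff_le:
  fixes a :: "real^'n"
  assumes "N > 0"
  shows "norm (a - hvec (cell N a) /\<^sub>R real N) \<le> sqrt (real CARD('n)) / real N"
proof -
  have "\<bar>(a - hvec (cell N a) /\<^sub>R real N) $ i\<bar> \<le> 1 / real N" for i
  proof -
    have "\<bar>real N * a $ i - of_int \<lfloor>real N * a $ i\<rfloor>\<bar> \<le> 1" by linarith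
    moreover have "(a - hvec (cell N a) /\<^sub>R real N) $ i = (real N * a $ i - of_int \<lfloor>real N * a $ i\<rfloor>) / real N"
      using assms by (simp add: cell_def field_simps)
    ultimately show ?thesis using assms by (simp add: divide_right_mono)
  qed
  from norm_vec_le_sqrt_card[OF this] show ?thesis by simp
qed

context
  fixes \<mu> :: "(real^'n) measure"
  assumes \<mu>: "torus_prob \<mu>"
begin

lemma prob_space_torus: "prob_space \<mu>"
  using \<mu> by (simp add: torus_prob_def)

lemma sets_torus: "sets \<mu> = sets (restrict_space borel torus_cube)"
  using \<mu> by (simp add: torus_prob_def)

lemma space_torus: "space \<mu> = torus_cube"
  using sets_eq_imp_space_eq[OF sets_torus] by (simp add: space_restrict_space)

lemma borel_measurable_torus: "f \<in> borel_measurable borel \<Longrightarrow> f \<in> borel_measurable \<mu>"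
  unfolding measurable_cong_sets[OF sets_torus refl] by (rule measurable_restrict_space1)

lemma cell_set_sets: "cell_set N x \<in> sets \<mu>"
proof -
  have "{a \<in> space \<mu>. \<lfloor>real N * a $ i\<rfloor> = x $ i} \<in> sets \<mu>" for i
  proof -
    have [measurable]: "(\<lambda>a. a $ i) \<in> borel_measurable \<mu>"
      by (intro borel_measurable_torus borel_measurable_continuous_onI continuous_intros)
    show ?thesis by measurable
  qed
  then have "{a \<in> space \<mu>. \<forall>i\<in>UNIV. \<lfloor>real N * a $ i\<rfloor> = x $ i} \<in> sets \<mu>"
    by (intro sets.sets_Collect_finite_All) auto
  then show ?thesis by (simp add: cell_set_def cell_def vec_eq_iff space_torus)
qed

lemma sum_cell_set:
  assumes "N > 0"
  shows "(\<Sum>x\<in>grid N. measure \<mu> (cell_set N x)) = 1"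
proof -
  interpret prob_space \<mu> by (rule prob_space_torus)
  have "measure \<mu> (\<Union>x\<in>grid N. cell_set N x) = (\<Sum>x\<in>grid N. measure \<mu> (cell_set N x))"
    by (intro finite_measure_finite_Union) (auto simp: cell_set_sets, auto simp: disjoint_family_on_def cell_set_def)
  moreover have "(\<Union>x\<in>grid N. cell_set N x) = space \<mu>"
    using cell_in_grid assms by (auto simp: cell_set_def space_torus)
  ultimately show ?thesis by (simp add: prob_space)
qed

text \<open>\<open>echar N h x\<close> is the character at the lower corner \<open>x / N\<close> of
  a cell, so the sum is the integral of a step function. The character has Lipschitz constant at
  most \<open>2 * pi * norm (hvec h)\<close>, and a cell lies within \<open>sqrt k / N\<close> of
  its corner.\<close>

lemma grid_fourier_approx:
  assumes N: "N > 0"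
  shows "cmod ((\<Sum>x\<in>grid N. of_real (measure \<mu> (cell_set N x)) * echar N h x) - fhat \<mu> h)
    \<le> 2 * pi * norm (hvec h) * sqrt (real CARD('n)) / real N"
proof -
  interpret prob_space \<mu> by (rule prob_space_torus)
  let ?S = "\<lambda>a. \<Sum>x\<in>grid N. indicator (cell_set N x) a *\<^sub>R echar N h x"
  have int_S: "integrable \<mu> ?S"
    by (intro Bochner_Integration.integrable_sum integrable_scaleR_left integrable_real_indicator)
       (auto simp: cell_set_sets emeasure_eq_measure)
  have "(\<lambda>a. cis (2 * pi * (hvec h \<bullet> a))) \<in> borel_measurable \<mu>"
    by (intro borel_measurable_torus borel_measurable_continuous_onI continuous_intros)
  then have int_cis: "integrable \<mu> (\<lambda>a. cis (2 * pi * (hvec h \<bullet> a)))"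
    by (intro integrable_const_bound[of _ 1]) auto
  have "(\<integral>a. ?S a \<partial>\<mu>) = (\<Sum>x\<in>grid N. measure \<mu> (cell_set N x) *\<^sub>R echar N h x)"
  proof -
    have "(\<integral>a. ?S a \<partial>\<mu>) = (\<Sum>x\<in>grid N. \<integral>a. indicator (cell_set N x) a *\<^sub>R echar N h x \<partial>\<mu>)"
      by (intro Bochner_Integration.integral_sum integrable_scaleR_left integrable_real_indicator)
         (auto simp: cell_set_sets emeasure_eq_measure)
    also have "\<dots> = (\<Sum>x\<in>grid N. measure \<mu> (cell_set N x) *\<^sub>R echar N h x)"
    proof (intro sum.cong refl)
      fix x :: "int^'n"
      have "integrable \<mu> (indicator (cell_set N x) :: _ \<Rightarrow> real)"
        by (intro integrable_real_indicator) (auto simp: cell_set_sets emeasure_eq_measure)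
      moreover have "cell_set N x \<inter> space \<mu> = cell_set N x"
        using sets.sets_into_space[OF cell_set_sets] by (rule Int_absorb2)
      ultimately show "(\<integral>a. indicator (cell_set N x) a *\<^sub>R echar N h x \<partial>\<mu>) = measure \<mu> (cell_set N x) *\<^sub>R echar N h x"
        by (simp only: integral_scaleR_left Bochner_Integration.integral_indicator)
    qed
    finally show ?thesis .
  qed
  then have "(\<Sum>x\<in>grid N. of_real (measure \<mu> (cell_set N x)) * echar N h x) - fhat \<mu> h =
      (\<integral>a. ?S a - cis (2 * pi * (hvec h \<bullet> a)) \<partial>\<mu>)"
    using int_S int_cis by (simp add: fhat_def scaleR_conv_of_real)
  also have "cmod \<dots> \<le> (\<integral>a. cmod (?S a - cis (2 * pi * (hvec h \<bullet> a))) \<partial>\<mu>)"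
    by (rule integral_norm_bound)
  also have "\<dots> \<le> (\<integral>a. 2 * pi * norm (hvec h) * sqrt (real CARD('n)) / real N \<partial>\<mu>)"
  proof (rule integral_mono')
    fix a assume a: "a \<in> space \<mu>"
    have "?S a = (\<Sum>x\<in>grid N. if x = cell N a then echar N h (cell N a) else 0)"
      using a by (intro sum.cong) (auto simp: cell_set_def space_torus)
    also have "\<dots> = echar N h (cell N a)"
      using cell_in_grid[of a N] a N by (simp add: space_torus)
    finally have S: "?S a = echar N h (cell N a)" .
    define s where "s = 2 * pi * (hvec h \<bullet> hvec (cell N a)) / real N"
    define t where "t = 2 * pi * (hvec h \<bullet> a)"
    have "cmod (cis s - cis t) = cmod (cis t * (cis (s - t) - 1))"
      by (simp add: cis_mult right_diff_distrib)
    also have "\<dots> \<le> \<bar>s - t\<bar>"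
      using iexp_approx1[of "s - t" 0] by (simp add: norm_mult cis_conv_exp)
    also have "s - t = - (2 * pi * (hvec h \<bullet> (a - hvec (cell N a) /\<^sub>R real N)))"
      by (simp add: s_def t_def inner_diff_right right_diff_distrib divide_inverse mult_ac)
    also have "\<bar>\<dots>\<bar> = 2 * pi * \<bar>hvec h \<bullet> (a - hvec (cell N a) /\<^sub>R real N)\<bar>"
      by (simp add: abs_mult)
    also have "\<dots> \<le> 2 * pi * (norm (hvec h) * norm (a - hvec (cell N a) /\<^sub>R real N))"
      by (intro mult_left_mono Cauchy_Schwarz_ineq2) auto
    also have "\<dots> \<le> 2 * pi * (norm (hvec h) * (sqrt (real CARD('n)) / real N))"
      by (intro mult_left_mono norm_cell_diff_le N) auto
    finally show "cmod (?S a - cis (2 * pi * (hvec h \<bullet> a))) \<le> 2 * pi * norm (hvec h) * sqrt (real CARD('n)) / real N"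
      unfolding S by (simp add: echar_def s_def t_def mult_ac)
  qed auto
  finally show ?thesis by (simp add: prob_space)
qed

end

text \<open>Replacing a point by the corner of its cell moves it by at most
  \<open>sqrt k / N\<close>; doing so at both ends of the transport accounts for the additive
  term.\<close>

lemma W1_le_of_grid_coupling:
  fixes \<mu> \<nu> :: "(real^'n) measure"
  assumes \<mu>: "torus_prob \<mu>" and \<nu>: "torus_prob \<nu>" and N: "N > 0"
    and P: "\<And>x y. x \<in> grid N \<Longrightarrow> y \<in> grid N \<Longrightarrow> 0 \<le> P x y"
    and row: "\<And>x. x \<in> grid N \<Longrightarrow> (\<Sum>y\<in>grid N. P x y) = measure \<mu> (cell_set N x)"
    and col: "\<And>y. y \<in> grid N \<Longrightarrow> (\<Sum>x\<in>grid N. P x y) = measure \<nu> (cell_set N y)"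
  shows "W1 \<mu> \<nu> \<le> (\<Sum>x\<in>grid N. \<Sum>y\<in>grid N. P x y * torus_dist (hvec x /\<^sub>R real N) (hvec y /\<^sub>R real N))
    + 2 * sqrt (real CARD('n)) / real N"
proof -
  have disj: "disjoint_family_on (cell_set N) (grid N)" by (auto simp: disjoint_family_on_def cell_set_def)
  have cover: "(\<Union>x\<in>grid N. cell_set N x) = torus_cube" using cell_in_grid N by (auto simp: cell_set_def)
  obtain \<pi> where \<pi>: "prob_space \<pi>" "sets \<pi> = sets (\<mu> \<Otimes>\<^sub>M \<nu>)"
    "distr \<pi> \<mu> fst = \<mu>" "distr \<pi> \<nu> snd = \<nu>"
    and cells: "\<And>x y. x \<in> grid N \<Longrightarrow> y \<in> grid N \<Longrightarrow> measure \<pi> (cell_set N x \<times> cell_set N y) = P x y"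
    by (rule coupling_of_finite_coupling[where M = \<mu> and M' = \<nu> and I = "grid N" and C = "cell_set N" and D = "cell_set N" and P = P])
      (auto simp: prob_space_torus \<mu> \<nu> cell_set_sets disj cover space_torus P row col)
  interpret prob_space \<pi> by fact
  let ?d = "\<lambda>x y. torus_dist (hvec x /\<^sub>R real N) (hvec y /\<^sub>R real N)"
  let ?R = "\<lambda>x y. cell_set N x \<times> cell_set N y"
  let ?F = "\<lambda>p. (\<Sum>x\<in>grid N. \<Sum>y\<in>grid N. indicator (?R x y) p * ?d x y) + 2 * sqrt (real CARD('n)) / real N"
  have space_\<pi>: "space \<pi> = torus_cube \<times> torus_cube"
    using sets_eq_imp_space_eq[OF \<pi>(2)] by (simp add: space_pair_measure space_torus \<mu> \<nu>)
  have R: "?R x y \<in> sets \<pi>" for x y using cell_set_sets[OF \<mu>] cell_set_sets[OF \<nu>] by (simp add: \<pi>(2))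
  have int_R: "integrable \<pi> (\<lambda>p. indicator (?R x y) p * ?d x y)" for x y
    using R by (intro integrable_mult_left integrable_real_indicator) (auto simp: emeasure_eq_measure)
  have int_F: "integrable \<pi> ?F" using int_R
    by (intro Bochner_Integration.integrable_add Bochner_Integration.integrable_sum integrable_const)
  have "W1 \<mu> \<nu> \<le> (\<integral>p. torus_dist (fst p) (snd p) \<partial>\<pi>)"
    unfolding W1_def using \<pi>
    by (intro cInf_lower bdd_belowI[of _ 0]) (auto simp: coupling_def torus_dist_nonneg)
  also have "\<dots> \<le> (\<integral>p. ?F p \<partial>\<pi>)"
  \<comment> \<open>The rule asks for integrability of the nonnegative majorant \<open>?F\<close>
    alone: the integral of a non-integrable function is 0 by default, and such a majorant covers
    that value too.\<close>
  proof (rule integral_mono'[OF int_F])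
    fix p assume p: "p \<in> space \<pi>"
    obtain a b where ab: "p = (a, b)" "a \<in> torus_cube" "b \<in> torus_cube" using p by (auto simp: space_\<pi>)
    let ?a = "hvec (cell N a) /\<^sub>R real N" and ?b = "hvec (cell N b) /\<^sub>R real N"
    have "(\<Sum>x\<in>grid N. \<Sum>y\<in>grid N. indicator (?R x y) p * ?d x y) =
        (\<Sum>x\<in>grid N. if x = cell N a then (\<Sum>y\<in>grid N. if y = cell N b then ?d (cell N a) (cell N b) else 0) else 0)"
      using ab by (intro sum.cong) (auto simp: cell_set_def indicator_def intro!: sum.cong sum.neutral)
    also have "\<dots> = ?d (cell N a) (cell N b)" using cell_in_grid[OF ab(2) N] cell_in_grid[OF ab(3) N] by simp
    finally have F: "?F p = torus_dist ?a ?b + 2 * sqrt (real CARD('n)) / real N" by simp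
    have "torus_dist a b \<le> torus_dist a ?a + (torus_dist ?a ?b + torus_dist ?b b)"
      using torus_dist_triangle[of a b ?a] torus_dist_triangle[of ?a b ?b] by linarith
    moreover have "torus_dist a ?a \<le> sqrt (real CARD('n)) / real N"
      using torus_dist_le[of a ?a] norm_cell_diff_le[OF N, of a] by linarith
    moreover have "torus_dist ?b b \<le> sqrt (real CARD('n)) / real N"
      using torus_dist_le[of ?b b] norm_cell_diff_le[OF N, of b] by (simp add: norm_minus_commute)
    ultimately show "torus_dist (fst p) (snd p) \<le> ?F p" unfolding F by (simp add: ab)
    show "0 \<le> ?F p" unfolding F by (simp add: torus_dist_nonneg)
  qed
  also have "(\<integral>p. ?F p \<partial>\<pi>) = (\<Sum>x\<in>grid N. \<Sum>y\<in>grid N. P x y * ?d x y) + 2 * sqrt (real CARD('n)) / real N"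
  proof -
    have "(\<integral>p. indicator (?R x y) p * ?d x y \<partial>\<pi>) = P x y * ?d x y" if "x \<in> grid N" "y \<in> grid N" for x y
      using R[of x y] cells[OF that] by (simp add: Int_absorb2 sets.sets_into_space)
    moreover have "(\<integral>p. ?F p \<partial>\<pi>) = (\<Sum>x\<in>grid N. \<Sum>y\<in>grid N. \<integral>p. indicator (?R x y) p * ?d x y \<partial>\<pi>)
        + (\<integral>p. 2 * sqrt (real CARD('n)) / real N \<partial>\<pi>)"
    proof -
      have "(\<integral>p. (\<Sum>x\<in>grid N. \<Sum>y\<in>grid N. indicator (?R x y) p * ?d x y) \<partial>\<pi>) =
          (\<Sum>x\<in>grid N. \<integral>p. (\<Sum>y\<in>grid N. indicator (?R x y) p * ?d x y) \<partial>\<pi>)"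
        by (intro Bochner_Integration.integral_sum Bochner_Integration.integrable_sum int_R)
      also have "\<dots> = (\<Sum>x\<in>grid N. \<Sum>y\<in>grid N. \<integral>p. indicator (?R x y) p * ?d x y \<partial>\<pi>)"
        by (intro sum.cong refl Bochner_Integration.integral_sum int_R)
      finally have "(\<integral>p. (\<Sum>x\<in>grid N. \<Sum>y\<in>grid N. indicator (?R x y) p * ?d x y) \<partial>\<pi>) =
          (\<Sum>x\<in>grid N. \<Sum>y\<in>grid N. \<integral>p. indicator (?R x y) p * ?d x y \<partial>\<pi>)" .
      moreover have "integrable \<pi> (\<lambda>p. \<Sum>x\<in>grid N. \<Sum>y\<in>grid N. indicator (?R x y) p * ?d x y)"
        by (intro Bochner_Integration.integrable_sum int_R)
      ultimately show ?thesis by (simp only: Bochner_Integration.integral_add integrable_const)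
    qed
    moreover have "(\<integral>p. 2 * sqrt (real CARD('n)) / real N \<partial>\<pi>) = 2 * sqrt (real CARD('n)) / real N"
      by (simp add: prob_space)
    ultimately show ?thesis by (simp cong: sum.cong del: integral_mult_left integral_mult_left_zero)
  qed
  finally show ?thesis .
qed

section \<open>The transport bound\<close>

text \<open>Integer entries are bounded by \<open>T\<close> exactly when they are bounded by its
  floor, and a nonzero integer vector has an entry of absolute value at least 1. For
  \<open>T < 1\<close> both sides are empty.\<close>

lemma freqs_minus_zero:
  assumes "T > 0"
  shows "freqs (nat \<lfloor>T\<rfloor>) - {0} = {h :: int^'n. 1 \<le> infnorm (hvec h) \<and> infnorm (hvec h) \<le> T}"
proof -
  have le: "infnorm (hvec h) \<le> c \<longleftrightarrow> (\<forall>i. \<bar>of_int (h $ i)\<bar> \<le> c)" for h :: "int^'n" and c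
  proof
    assume "infnorm (hvec h) \<le> c"
    then show "\<forall>i. \<bar>of_int (h $ i)\<bar> \<le> c"
      using component_le_infnorm_cart[of "hvec h"] by (force intro: order_trans)
  next
    assume "\<forall>i. \<bar>of_int (h $ i)\<bar> \<le> c"
    then show "infnorm (hvec h) \<le> c"
      unfolding infnorm_cart by (intro cSup_least) auto
  qed
  have "h \<in> freqs (nat \<lfloor>T\<rfloor>) \<longleftrightarrow> infnorm (hvec h) \<le> T" for h :: "int^'n"
    unfolding le freqs_def using assms by (auto simp: le_floor_iff)
  moreover have "1 \<le> infnorm (hvec h) \<longleftrightarrow> h \<noteq> 0" for h :: "int^'n"
  proof
    assume "h \<noteq> 0"
    then obtain i where "h $ i \<noteq> 0" by (auto simp: vec_eq_iff)
    then have "1 \<le> \<bar>h $ i\<bar>" by linarith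
    then have "1 \<le> \<bar>hvec h $ i\<bar>" by simp
    then show "1 \<le> infnorm (hvec h)" using component_le_infnorm_cart order_trans by blast
  qed (auto simp: infnorm_0)
  ultimately show ?thesis by auto
qed

text \<open>Cauchy-Schwarz with the weights \<open>norm (hvec h)\<close> and their inverses. The
  frequency 0 has weight 0, so it must drop out beforehand; in the application
  \<open>\<Delta> 0 = 0\<close> says that the two measures have equal mass.\<close>

lemma sum_smoothed_le:
  fixes c \<Delta> :: "int^'n \<Rightarrow> complex"
  assumes c: "(\<Sum>h\<in>freqs m. (norm (hvec h))\<^sup>2 * (cmod (c h))\<^sup>2) \<le> 1" and zero: "\<Delta> 0 = 0"
  shows "cmod (\<Sum>h\<in>freqs m. c h * \<Delta> h) \<le> sqrt (\<Sum>h\<in>freqs m - {0}. (cmod (\<Delta> h))\<^sup>2 / (norm (hvec h))\<^sup>2)"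
proof -
  let ?H = "freqs m - {0 :: int^'n}"
  have pos: "norm (hvec h) > 0" if "h \<in> ?H" for h :: "int^'n"
  proof -
    have "hvec h \<noteq> 0" using that by (auto simp: vec_eq_iff)
    then show ?thesis by simp
  qed
  have "cmod (\<Sum>h\<in>freqs m. c h * \<Delta> h) = cmod (\<Sum>h\<in>?H. c h * \<Delta> h)"
    using zero by (intro arg_cong[where f = cmod] sum.mono_neutral_right) auto
  also have "\<dots> \<le> (\<Sum>h\<in>?H. \<bar>norm (hvec h) * cmod (c h)\<bar> * \<bar>cmod (\<Delta> h) / norm (hvec h)\<bar>)"
    using pos by (intro sum_norm_le) (force simp: norm_mult)
  also have "\<dots> \<le> L2_set (\<lambda>h. norm (hvec h) * cmod (c h)) ?H * L2_set (\<lambda>h. cmod (\<Delta> h) / norm (hvec h)) ?H"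
    by (rule L2_set_mult_ineq)
  also have "\<dots> \<le> 1 * L2_set (\<lambda>h. cmod (\<Delta> h) / norm (hvec h)) ?H"
  proof (intro mult_right_mono)
    have "(\<Sum>h\<in>?H. (norm (hvec h) * cmod (c h))\<^sup>2) \<le> (\<Sum>h\<in>freqs m. (norm (hvec h))\<^sup>2 * (cmod (c h))\<^sup>2)"
      unfolding power_mult_distrib by (intro sum_mono2) auto
    then show "L2_set (\<lambda>h. norm (hvec h) * cmod (c h)) ?H \<le> 1"
      using c by (simp add: L2_set_def)
  qed (simp add: L2_set_nonneg)
  finally show ?thesis by (simp add: L2_set_def power_divide)
qed

text \<open>The degree m is fixed and only N varies, so the Fourier sum on the right is over a fixed
  finite set and can be passed to the limit term by term.\<close>

lemma W1_le_grid_fourier: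
  fixes \<mu> \<nu> :: "(real^'n) measure" and m :: nat
  assumes \<mu>: "torus_prob \<mu>" and \<nu>: "torus_prob \<nu>"
  obtains N0 where "\<And>N. N \<ge> N0 \<Longrightarrow> W1 \<mu> \<nu> \<le> sqrt (real CARD('n)) * pi / (real m + 2)
    + sqrt (\<Sum>h\<in>freqs m - {0}. (cmod (\<Sum>x\<in>grid N.
        of_real (measure \<mu> (cell_set N x) - measure \<nu> (cell_set N x)) * echar N h x))\<^sup>2 / (norm (hvec h))\<^sup>2)
    + 2 * sqrt (real CARD('n)) / real N"
proof -
  obtain N1 where smooth: "\<And>N (f :: int^'n \<Rightarrow> real). N \<ge> N1 \<Longrightarrow> (\<And>x. f (gmod N x) = f x) \<Longrightarrow>
      (\<And>x y. \<bar>f x - f y\<bar> \<le> norm (hvec (x - y)) / real N) \<Longrightarrow> f 0 = 0 \<Longrightarrow>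
      \<exists>c. (\<forall>x. cmod (of_real (f x) - (\<Sum>h\<in>freqs m. c h * echar N h x)) \<le> sqrt (real CARD('n)) * pi / (2 * (real m + 2)))
        \<and> (\<Sum>h\<in>freqs m. (norm (hvec h))\<^sup>2 * (cmod (c h))\<^sup>2) \<le> 1"
    using lipschitz_grid_smoothing by blast
  show thesis
  proof (rule that[of "max N1 1"])
    fix N assume "N \<ge> max N1 1"
    then have N1: "N \<ge> N1" and N: "N > 0" by auto
    define p where "p x = measure \<mu> (cell_set N x)" for x
    define q where "q x = measure \<nu> (cell_set N x)" for x
    define d where "d x y = torus_dist (hvec x /\<^sub>R real N) (hvec y /\<^sub>R real N)" for x y :: "int^'n"
    define \<Delta> where "\<Delta> h = (\<Sum>x\<in>grid N. of_real (p x - q x) * echar N h x)" for h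
    define \<epsilon> where "\<epsilon> = sqrt (real CARD('n)) * pi / (2 * (real m + 2))"
    have eps: "2 * \<epsilon> = sqrt (real CARD('n)) * pi / (real m + 2)" by (simp add: \<epsilon>_def field_simps)
    define D where "D = 2 * \<epsilon> + sqrt (\<Sum>h\<in>freqs m - {0}. (cmod (\<Delta> h))\<^sup>2 / (norm (hvec h))\<^sup>2)"
    have pq: "0 \<le> p x" "0 \<le> q x" "sum p (grid N) = 1" "sum q (grid N) = 1" for x
      using sum_cell_set[OF \<mu> N] sum_cell_set[OF \<nu> N] by (simp_all add: p_def q_def)
    have bound: "(\<Sum>x\<in>grid N. f x * (p x - q x)) \<le> D"
      if f: "\<And>x y. x \<in> grid N \<Longrightarrow> y \<in> grid N \<Longrightarrow> f x - f y \<le> d x y" for f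
    proof -
      \<comment> \<open>The test function is controlled on the grid only. \<open>F\<close> extends
        it periodically and shifts it to vanish at 0, as the smoothing requires; the shift leaves
        the pairing unchanged because \<open>p\<close> and \<open>q\<close> have the same total
        mass.\<close>
      define F where "F x = f (gmod N x) - f (gmod N 0)" for x
      have F_le: "F x - F y \<le> norm (hvec (x - y)) / real N" for x y
      proof -
        \<comment> \<open>This integer translate undoes the reduction modulo N: with it, the norm
          inside \<open>torus_dist\<close> becomes the Euclidean distance of \<open>x / N\<close>
          and \<open>y / N\<close>.\<close>
        define z :: "real^'n" where "z = (\<chi> i. of_int (y $ i div int N) - of_int (x $ i div int N))"
        have gm: "real_of_int (x $ i mod int N) = of_int (x $ i) - real N * of_int (x $ i div int N)" for x :: "int^'n" and i
          by (simp add: minus_mult_div_eq_mod[symmetric])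
        have "hvec (gmod N x) /\<^sub>R real N - hvec (gmod N y) /\<^sub>R real N - z = hvec (x - y) /\<^sub>R real N"
          using N by (simp add: vec_eq_iff gmod_def z_def gm field_simps)
        moreover have "F x - F y \<le> d (gmod N x) (gmod N y)"
          using f[of "gmod N x" "gmod N y"] N by (simp add: F_def gmod_in_grid)
        ultimately show ?thesis
          using torus_dist_le_norm[of z "hvec (gmod N x) /\<^sub>R real N" "hvec (gmod N y) /\<^sub>R real N"]
          by (simp add: d_def z_def divide_inverse mult.commute)
      qed
      have F_lip: "\<bar>F x - F y\<bar> \<le> norm (hvec (x - y)) / real N" for x y
        using F_le[of x y] F_le[of y x] by (simp add: abs_le_iff hvec_diff norm_minus_commute)
      have "F (gmod N x) = F x" "F 0 = 0" for x by (simp_all add: F_def)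
      from smooth[OF N1 this(1) F_lip this(2)] obtain c
        where approx: "\<And>x. cmod (of_real (F x) - (\<Sum>h\<in>freqs m. c h * echar N h x)) \<le> \<epsilon>"
          and c: "(\<Sum>h\<in>freqs m. (norm (hvec h))\<^sup>2 * (cmod (c h))\<^sup>2) \<le> 1"
        unfolding \<epsilon>_def by blast
      define P where "P x = (\<Sum>h\<in>freqs m. c h * echar N h x)" for x
      have "(\<Sum>x\<in>grid N. f x * (p x - q x)) = (\<Sum>x\<in>grid N. F x * (p x - q x)) + f (gmod N 0) * (sum p (grid N) - sum q (grid N))"
        unfolding sum_subtractf[symmetric] sum_distrib_left sum.distrib[symmetric]
        by (intro sum.cong) (auto simp: F_def gmod_grid algebra_simps)
      then have f_F: "(\<Sum>x\<in>grid N. f x * (p x - q x)) = (\<Sum>x\<in>grid N. F x * (p x - q x))" by (simp add: pq)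
      have "complex_of_real (\<Sum>x\<in>grid N. F x * (p x - q x)) =
          (\<Sum>x\<in>grid N. (of_real (F x) - P x) * of_real (p x - q x)) + (\<Sum>x\<in>grid N. P x * of_real (p x - q x))"
        by (simp add: sum.distrib[symmetric] algebra_simps)
      also have "(\<Sum>x\<in>grid N. P x * of_real (p x - q x)) = (\<Sum>h\<in>freqs m. c h * \<Delta> h)"
        unfolding P_def \<Delta>_def sum_distrib_left sum_distrib_right
        by (subst sum.swap) (simp add: mult_ac)
      finally have split: "complex_of_real (\<Sum>x\<in>grid N. F x * (p x - q x)) =
          (\<Sum>x\<in>grid N. (of_real (F x) - P x) * of_real (p x - q x)) + (\<Sum>h\<in>freqs m. c h * \<Delta> h)" .
      \<comment> \<open>The weights \<open>p + q\<close> have total mass 2, so the uniform error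
        \<open>\<epsilon>\<close> is counted twice.\<close>
      have "cmod (\<Sum>x\<in>grid N. (of_real (F x) - P x) * of_real (p x - q x)) \<le> (\<Sum>x\<in>grid N. \<epsilon> * (p x + q x))"
      proof (rule sum_norm_le)
        fix x :: "int^'n"
        have "\<bar>p x - q x\<bar> \<le> p x + q x" using pq(1,2)[of x] by linarith
        then have "cmod (of_real (F x) - P x) * \<bar>p x - q x\<bar> \<le> \<epsilon> * (p x + q x)"
          using approx[of x] order_trans[OF norm_ge_zero approx[of x]]
          unfolding P_def by (intro mult_mono) auto
        then show "cmod ((of_real (F x) - P x) * of_real (p x - q x)) \<le> \<epsilon> * (p x + q x)"
          by (simp only: norm_mult norm_of_real)
      qed
      also have "\<dots> = 2 * \<epsilon>" by (simp add: sum_distrib_left[symmetric] sum.distrib pq)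
      finally have 1: "cmod (\<Sum>x\<in>grid N. (of_real (F x) - P x) * of_real (p x - q x)) \<le> 2 * \<epsilon>" .
      have "\<Delta> 0 = of_real (sum p (grid N) - sum q (grid N))" by (simp add: \<Delta>_def sum_subtractf)
      then have "\<Delta> 0 = 0" by (simp add: pq)
      note 2 = sum_smoothed_le[where c = c and \<Delta> = \<Delta>, OF c this]
      have "(\<Sum>x\<in>grid N. F x * (p x - q x)) \<le> cmod (complex_of_real (\<Sum>x\<in>grid N. F x * (p x - q x)))"
        unfolding norm_of_real by (rule abs_ge_self)
      also have "\<dots> \<le> D" unfolding split D_def by (intro order_trans[OF norm_triangle_ineq] add_mono 1 2)
      finally show ?thesis by (simp only: f_F)
    qed
    obtain P where P: "\<And>x y. x \<in> grid N \<Longrightarrow> y \<in> grid N \<Longrightarrow> 0 \<le> P x y"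
      "\<And>x. x \<in> grid N \<Longrightarrow> (\<Sum>y\<in>grid N. P x y) = p x"
      "\<And>y. y \<in> grid N \<Longrightarrow> (\<Sum>x\<in>grid N. P x y) = q y"
      "(\<Sum>x\<in>grid N. \<Sum>y\<in>grid N. P x y * d x y) \<le> D"
      by (rule finite_kantorovich_duality[of "grid N" p q d D])
        (use pq bound in \<open>auto simp: d_def torus_dist_triangle\<close>)
    have "W1 \<mu> \<nu> \<le> (\<Sum>x\<in>grid N. \<Sum>y\<in>grid N. P x y * d x y) + 2 * sqrt (real CARD('n)) / real N"
      unfolding d_def by (rule W1_le_of_grid_coupling[OF \<mu> \<nu> N P(1) P(2)[unfolded p_def] P(3)[unfolded q_def]])
    also have "\<dots> \<le> D + 2 * sqrt (real CARD('n)) / real N" using P(4) by simp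
    finally show "W1 \<mu> \<nu> \<le> sqrt (real CARD('n)) * pi / (real m + 2)
      + sqrt (\<Sum>h\<in>freqs m - {0}. (cmod (\<Sum>x\<in>grid N.
          of_real (measure \<mu> (cell_set N x) - measure \<nu> (cell_set N x)) * echar N h x))\<^sup>2 / (norm (hvec h))\<^sup>2)
      + 2 * sqrt (real CARD('n)) / real N"
      unfolding D_def eps \<Delta>_def p_def q_def .
  qed
qed

lemma grid_fourier_tendsto:
  fixes \<mu> :: "(real^'n) measure"
  assumes "torus_prob \<mu>"
  shows "(\<lambda>N. \<Sum>x\<in>grid N. of_real (measure \<mu> (cell_set N x)) * echar N h x) \<longlonglongrightarrow> fhat \<mu> h"
proof (rule LIM_zero_cancel, rule Lim_null_comparison)
  show "\<forall>\<^sub>F N in sequentially. norm ((\<Sum>x\<in>grid N. of_real (measure \<mu> (cell_set N x)) * echar N h x) - fhat \<mu> h)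
      \<le> 2 * pi * norm (hvec h) * sqrt (real CARD('n)) / real N"
    using grid_fourier_approx[OF assms] by (auto intro!: eventually_sequentiallyI[of 1])
qed real_asymp

theorem theorem1p1:
  fixes \<mu> \<nu> :: "(real^'n) measure" and T :: real
  assumes "torus_prob \<mu>" and "torus_prob \<nu>" and "T > 0"
  shows "W1 \<mu> \<nu> \<le> 4 * sqrt 3 * sqrt (real CARD('n)) / T +
    sqrt (\<Sum>h\<in>{h::int^'n. 1 \<le> infnorm (hvec h) \<and> infnorm (hvec h) \<le> T}.
            (cmod (fhat \<mu> h - fhat \<nu> h))\<^sup>2 / (norm (hvec h))\<^sup>2)"
proof -
  define m where "m = nat \<lfloor>T\<rfloor>"
  define b where "b = sqrt (real CARD('n)) * pi / (real m + 2)"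
  obtain N0 where N0: "\<And>N. N \<ge> N0 \<Longrightarrow> W1 \<mu> \<nu> \<le> b
    + sqrt (\<Sum>h\<in>freqs m - {0}. (cmod (\<Sum>x\<in>grid N.
        of_real (measure \<mu> (cell_set N x) - measure \<nu> (cell_set N x)) * echar N h x))\<^sup>2 / (norm (hvec h))\<^sup>2)
    + 2 * sqrt (real CARD('n)) / real N"
    unfolding b_def using W1_le_grid_fourier[OF assms(1,2)] by blast
  have diff: "(\<lambda>N. \<Sum>x\<in>grid N. of_real (measure \<mu> (cell_set N x) - measure \<nu> (cell_set N x)) * echar N h x)
      \<longlonglongrightarrow> fhat \<mu> h - fhat \<nu> h" for h
    using tendsto_diff[OF grid_fourier_tendsto[OF assms(1)] grid_fourier_tendsto[OF assms(2)], of h h]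
    by (simp add: sum_subtractf[symmetric] left_diff_distrib)
  have inv: "(\<lambda>N. 2 * sqrt (real CARD('n)) / real N) \<longlonglongrightarrow> 0" by real_asymp
  have "(\<lambda>N. b + sqrt (\<Sum>h\<in>freqs m - {0}. (cmod (\<Sum>x\<in>grid N.
        of_real (measure \<mu> (cell_set N x) - measure \<nu> (cell_set N x)) * echar N h x))\<^sup>2 / (norm (hvec h))\<^sup>2)
      + 2 * sqrt (real CARD('n)) / real N)
    \<longlonglongrightarrow> b + sqrt (\<Sum>h\<in>freqs m - {0}. (cmod (fhat \<mu> h - fhat \<nu> h))\<^sup>2 / (norm (hvec h))\<^sup>2) + 0"
    unfolding divide_inverse[of "_\<^sup>2"]
    by (intro tendsto_add tendsto_const inv tendsto_real_sqrt tendsto_sum tendsto_mult tendsto_power tendsto_norm diff)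
  then have "W1 \<mu> \<nu> \<le> b + sqrt (\<Sum>h\<in>freqs m - {0}. (cmod (fhat \<mu> h - fhat \<nu> h))\<^sup>2 / (norm (hvec h))\<^sup>2) + 0"
    by (rule LIMSEQ_le_const) (use N0 in blast)
  \<comment> \<open>Since \<open>m\<close> is the integer part of \<open>T\<close>, already
    \<open>T < m + 1\<close>. The argument yields the constant \<open>pi\<close>, well below
    \<open>4 * sqrt 3\<close>.\<close>
  moreover have "b \<le> 4 * sqrt 3 * sqrt (real CARD('n)) / T"
  proof -
    have "T \<le> real m + 2" using assms(3) unfolding m_def by linarith
    moreover have "pi \<le> 4 * sqrt 3" using pi_less_4 real_sqrt_ge_1_iff[of 3] by linarith
    ultimately have "pi / (real m + 2) \<le> 4 * sqrt 3 / T" using assms(3) by (intro frac_le) auto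
    from mult_left_mono[OF this, of "sqrt (real CARD('n))"] show ?thesis
      by (simp add: b_def mult_ac)
  qed
  ultimately show ?thesis unfolding freqs_minus_zero[OF assms(3), symmetric] m_def by simp
qed

end
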